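(* There are absolute constants $c,c'>0$ such that for all (sufficiently large) odd $n$, every deletion probability $\delta\ge c/\sqrt n$ (in particular every constant $\delta\in(0,1)$) and every scaling factor $0<\alpha\le c'\sqrt n$, the statistical (total variation) distance between the distribution of a single trace from $S_e$ and the distribution of a single trace from $S_o$ is $e^{-\Omega(\sqrt n)}$.
   Context: Let $bin(n,p,k)=\binom nk p^k(1-p)^{n-k}$. For odd $n$ and a parameter $\alpha>0$, $S_e$ and $S_o$ are strings of $n+1$ probabilities indexed by $i\in\{0,\ldots,n\}$: $S_e(i)=\alpha\,bin(n,\tfrac12,i)$ for even $i$ and $S_e(i)=0$ for odd $i$; $S_o(i)=\alpha\,bin(n,\tfrac12,i)$ for odd $i$ and $S_o(i)=0$ for even $i$. A trace of a string of probabilities $p_0,\ldots,p_n$ with deletion probability $\delta$ is obtained by sampling independent bits $t_i$ with $\Pr[t_i=1]=p_i$, then deleting each bit independently with probability $\delta$ and concatenating the surviving bits. *)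

theory Defs
  imports "HOL-Probability.Probability"
begin

definition bin :: "nat \<Rightarrow> real \<Rightarrow> nat \<Rightarrow> real" where
  "bin n p k = real (n choose k) * p ^ k * (1 - p) ^ (n - k)"

definition S_e :: "nat \<Rightarrow> real \<Rightarrow> real list" where
  "S_e n \<alpha> = map (\<lambda>i. if even i then \<alpha> * bin n (1/2) i else 0) [0..<Suc n]"

definition S_o :: "nat \<Rightarrow> real \<Rightarrow> real list" where
  "S_o n \<alpha> = map (\<lambda>i. if odd i then \<alpha> * bin n (1/2) i else 0) [0..<Suc n]"

fun trace_pmf :: "real \<Rightarrow> real list \<Rightarrow> bool list pmf" where
  "trace_pmf \<delta> [] = return_pmf []"
| "trace_pmf \<delta> (p # ps) =
     bind_pmf (bernoulli_pmf p) (\<lambda>t.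
     bind_pmf (bernoulli_pmf (1 - \<delta>)) (\<lambda>keep.
     map_pmf (\<lambda>rest. if keep then t # rest else rest) (trace_pmf \<delta> ps)))"

definition tv_dist :: "'a pmf \<Rightarrow> 'a pmf \<Rightarrow> real" where
  "tv_dist P Q = (1/2) * infsum (\<lambda>x. \<bar>pmf P x - pmf Q x\<bar>) UNIV"

end

theory Submission
  imports Defs
begin

text \<open>Averaging a test function over a trace is a product of \<open>n + 1\<close> operators
\<open>A + p\<^sub>i B\<close>, where \<open>A\<close> deletes a bit or keeps a zero and \<open>B\<close> corrects a kept zero to a one.
Expanding the product gives a sum over the sets \<open>X\<close> of positions at which \<open>B\<close> is chosen, and only sets of
constant parity contribute. Grouping the sets into translates \<open>s + Z\<close> with \<open>0 \<in> Z\<close>, the difference between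
\<open>S_e\<close> and \<open>S_o\<close> becomes, for each \<open>Z\<close>, an alternating sum over the shift \<open>s\<close>. The two outer powers of \<open>A\<close>
contribute \<open>(s choose d\<^sub>0) * (M - s choose d\<^sub>1)\<close>, where \<open>M = n - Max Z\<close> and \<open>d\<^sub>0\<close>, \<open>d\<^sub>1\<close> count the bits kept on the
two sides; together with the binomial probabilities this is a binomial weight \<open>L choose j\<close> in
\<open>j = s - d\<^sub>0\<close>, with \<open>L = M - d\<^sub>0 - d\<^sub>1\<close> the number of outer deletions, times a product of smooth binomial
coefficients. The alternating sum is therefore an iterated difference of order about \<open>\<surd>n\<close>
of a slowly varying function, which is exponentially small unless \<open>X\<close> is too large or too spread out, or
too few bits are deleted; these exceptions are controlled by exponential moments.\<close>

section \<open>Expectations over traces\<close>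

definition step_keep :: "real \<Rightarrow> (bool list \<Rightarrow> real) \<Rightarrow> bool list \<Rightarrow> real" where
  "step_keep \<delta> \<phi> y = \<delta> * \<phi> y + (1 - \<delta>) * \<phi> (False # y)"

definition step_flip :: "real \<Rightarrow> (bool list \<Rightarrow> real) \<Rightarrow> bool list \<Rightarrow> real" where
  "step_flip \<delta> \<phi> y = (1 - \<delta>) * (\<phi> (True # y) - \<phi> (False # y))"

text \<open>\<open>y\<close> is the part of the trace coming from later positions, so the operator
  of the first position acts on the test function first. The form affine in \<open>p\<close> is what
  makes the product expandable.\<close>

definition step :: "real \<Rightarrow> real \<Rightarrow> (bool list \<Rightarrow> real) \<Rightarrow> bool list \<Rightarrow> real" where
  "step \<delta> p \<phi> y = step_keep \<delta> \<phi> y + p * step_flip \<delta> \<phi> y"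

lemma finite_set_trace_pmf: "finite (set_pmf (trace_pmf \<delta> ps))"
  by (induction ps) (auto)

text \<open>Conditioning on the first bit replaces the test function by
  \<open>step \<delta> p \<phi>\<close> and shortens the string. \<open>bernoulli_pmf\<close> clamps
  its argument, so the bounds on \<open>\<delta>\<close> and \<open>p\<close> make the weights the
  intended ones.\<close>

lemma expectation_trace_pmf:
  assumes "0 \<le> \<delta>" "\<delta> \<le> 1" "\<forall>p \<in> set ps. 0 \<le> p \<and> p \<le> 1"
  shows "measure_pmf.expectation (trace_pmf \<delta> ps) \<phi> = foldl (\<lambda>\<psi> p. step \<delta> p \<psi>) \<phi> ps []"
  using assms(3)
proof (induction ps arbitrary: \<phi>)
  case Nil
  then show ?case by simp
next
  case (Cons p ps)
  let ?T = "trace_pmf \<delta> ps"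
  let ?E = "measure_pmf.expectation ?T"
  have int: "integrable (measure_pmf ?T) f" for f :: "bool list \<Rightarrow> real"
    by (rule integrable_measure_pmf_finite[OF finite_set_trace_pmf])
  have p: "0 \<le> p" "p \<le> 1" using Cons.prems by auto
  have fin: "finite (set_pmf (bind_pmf (bernoulli_pmf (1 - \<delta>)) (\<lambda>keep.
     map_pmf (\<lambda>rest. if keep then t # rest else rest) ?T)))" for t
    by (auto simp: finite_set_trace_pmf)
  have inner: "measure_pmf.expectation (bind_pmf (bernoulli_pmf (1 - \<delta>)) (\<lambda>keep.
     map_pmf (\<lambda>rest. if keep then t # rest else rest) ?T)) \<phi>
     = \<delta> * ?E \<phi> + (1 - \<delta>) * ?E (\<lambda>r. \<phi> (t # r))" for t
    by (subst pmf_expectation_bind[where A = UNIV])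
       (use assms finite_set_trace_pmf in \<open>auto simp: UNIV_bool algebra_simps\<close>)
  have "measure_pmf.expectation (trace_pmf \<delta> (p # ps)) \<phi>
      = p * (\<delta> * ?E \<phi> + (1 - \<delta>) * ?E (\<lambda>r. \<phi> (True # r)))
        + (1 - p) * (\<delta> * ?E \<phi> + (1 - \<delta>) * ?E (\<lambda>r. \<phi> (False # r)))"
    unfolding trace_pmf.simps
    by (subst pmf_expectation_bind[where A = UNIV, OF _ fin])
       (auto simp: UNIV_bool inner p)
  also have "\<dots> = ?E (step \<delta> p \<phi>)"
    unfolding step_def step_keep_def step_flip_def
    by (simp add: int algebra_simps)
  also have "\<dots> = foldl (\<lambda>\<psi> p. step \<delta> p \<psi>) (step \<delta> p \<phi>) ps []"
    using Cons by simp
  finally show ?case by simp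
qed

text \<open>The sign of the difference of the mass functions is an extremal test function; finite
  supports reduce the infinite sum to a finite one.\<close>

lemma tv_dist_le_expectation:
  assumes "finite (set_pmf P)" "finite (set_pmf Q)"
    and "\<And>\<phi>. (\<And>y. \<bar>\<phi> y\<bar> \<le> 1) \<Longrightarrow>
      measure_pmf.expectation P \<phi> - measure_pmf.expectation Q \<phi> \<le> B"
  shows "tv_dist P Q \<le> B / 2"
proof -
  let ?S = "set_pmf P \<union> set_pmf Q"
  let ?\<phi> = "\<lambda>x. sgn (pmf P x - pmf Q x)"
  have fin: "finite ?S" using assms by simp
  have "infsum (\<lambda>x. \<bar>pmf P x - pmf Q x\<bar>) UNIV = infsum (\<lambda>x. \<bar>pmf P x - pmf Q x\<bar>) ?S"
    by (rule infsum_cong_neutral) (auto simp: set_pmf_iff)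
  also have "\<dots> = (\<Sum>x\<in>?S. \<bar>pmf P x - pmf Q x\<bar>)" using fin by simp
  also have "\<dots> = (\<Sum>x\<in>?S. ?\<phi> x * pmf P x) - (\<Sum>x\<in>?S. ?\<phi> x * pmf Q x)"
    by (simp add: sum_subtractf[symmetric] abs_sgn algebra_simps)
  also have "\<dots> = measure_pmf.expectation P ?\<phi> - measure_pmf.expectation Q ?\<phi>"
    by (simp add: integral_measure_pmf_real[OF fin])
  also have "\<dots> \<le> B" by (rule assms(3)) (simp add: sgn_if)
  finally show ?thesis by (simp add: tv_dist_def)
qed

text \<open>One term of the expanded product: \<open>X\<close> holds the positions below
  \<open>m\<close> at which the correction operator is chosen. Position 0 is innermost.\<close>

fun path_op :: "real \<Rightarrow> nat set \<Rightarrow> nat \<Rightarrow> (bool list \<Rightarrow> real) \<Rightarrow> bool list \<Rightarrow> real" where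
  "path_op \<delta> X 0 \<phi> = \<phi>"
| "path_op \<delta> X (Suc m) \<phi> = (if m \<in> X then step_flip \<delta> else step_keep \<delta>) (path_op \<delta> X m \<phi>)"

lemma step_keep_sum: "step_keep \<delta> (\<lambda>y. \<Sum>i\<in>I. c i * f i y) y = (\<Sum>i\<in>I. c i * step_keep \<delta> (f i) y)"
  unfolding step_keep_def sum_distrib_left sum.distrib[symmetric]
  by (simp add: algebra_simps)

lemma step_flip_sum: "step_flip \<delta> (\<lambda>y. \<Sum>i\<in>I. c i * f i y) y = (\<Sum>i\<in>I. c i * step_flip \<delta> (f i) y)"
  unfolding step_flip_def sum_subtractf[symmetric] sum_distrib_left
  by (simp add: algebra_simps)

lemma path_op_sum:
  "path_op \<delta> X m (\<lambda>y. \<Sum>i\<in>I. c i * f i y) = (\<lambda>y. \<Sum>i\<in>I. c i * path_op \<delta> X m (f i) y)"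
proof (induction m)
  case 0
  show ?case by (simp only: path_op.simps)
next
  case (Suc m)
  show ?case
  proof (cases "m \<in> X")
    case True
    show ?thesis
      unfolding path_op.simps Suc.IH if_P[OF True] by (rule ext, rule step_flip_sum)
  next
    case False
    show ?thesis
      unfolding path_op.simps Suc.IH if_not_P[OF False] by (rule ext, rule step_keep_sum)
  qed
qed

lemma path_op_cong:
  assumes "\<And>x. x < m \<Longrightarrow> x \<in> X \<longleftrightarrow> x \<in> Y"
  shows "path_op \<delta> X m \<phi> = path_op \<delta> Y m \<phi>"
  using assms by (induction m) simp_all

lemma foldl_step_eq_sum:
  "foldl (\<lambda>\<psi> p. step \<delta> p \<psi>) \<phi> (map p [0..<m])
    = (\<lambda>y. \<Sum>X\<in>Pow {..<m}. (\<Prod>x\<in>X. p x) * path_op \<delta> X m \<phi> y)"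
proof (induction m)
  case (Suc m)
  let ?P = "\<lambda>X. \<Prod>x\<in>X. p x"
  have inj: "inj_on (insert m) (Pow {..<m})" by (auto simp: inj_on_def)
  have fresh: "m \<notin> X" "finite X" if "X \<in> Pow {..<m}" for X
    using that by (auto intro: finite_subset)
  have split: "(\<Sum>X\<in>Pow {..<Suc m}. f X) = (\<Sum>X\<in>Pow {..<m}. f X) + (\<Sum>X\<in>Pow {..<m}. f (insert m X))"
    for f :: "nat set \<Rightarrow> real"
  proof -
    have "Pow {..<Suc m} = Pow {..<m} \<union> insert m ` Pow {..<m}"
      by (simp add: lessThan_Suc Pow_insert)
    moreover have "Pow {..<m} \<inter> insert m ` Pow {..<m} = {}" by auto
    ultimately show ?thesis
      by (simp add: sum.union_disjoint sum.reindex[OF inj])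
  qed
  have keep: "?P X * path_op \<delta> X (Suc m) \<phi> y = ?P X * step_keep \<delta> (path_op \<delta> X m \<phi>) y"
    if "X \<in> Pow {..<m}" for X y
    using fresh[OF that] by simp
  have flip: "?P (insert m X) * path_op \<delta> (insert m X) (Suc m) \<phi> y
        = p m * (?P X * step_flip \<delta> (path_op \<delta> X m \<phi>) y)" if X: "X \<in> Pow {..<m}" for X y
  proof -
    have "path_op \<delta> (insert m X) m \<phi> = path_op \<delta> X m \<phi>"
      by (rule path_op_cong) auto
    then show ?thesis using fresh[OF X] by simp
  qed
  have "step \<delta> (p m) (\<lambda>y. \<Sum>X\<in>Pow {..<m}. ?P X * path_op \<delta> X m \<phi> y) y
      = (\<Sum>X\<in>Pow {..<Suc m}. ?P X * path_op \<delta> X (Suc m) \<phi> y)" for y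
    unfolding step_def step_keep_sum step_flip_sum split sum_distrib_left
    by (intro arg_cong2[where f = "(+)"] sum.cong) (simp_all only: keep flip)
  then show ?case using Suc.IH by simp
qed simp

text \<open>\<open>step_keep\<close> averages and cannot increase the supremum; each
  \<open>step_flip\<close> at most doubles it.\<close>

lemma abs_path_op_le:
  assumes "0 \<le> \<delta>" "\<delta> \<le> 1" "\<And>y. \<bar>\<phi> y\<bar> \<le> 1"
  shows "\<bar>path_op \<delta> X m \<phi> y\<bar> \<le> 2 ^ card (X \<inter> {..<m})"
proof (induction m arbitrary: y)
  case 0
  then show ?case using assms(3) by simp
next
  case (Suc m)
  let ?B = "2 ^ card (X \<inter> {..<m}) :: real"
  let ?f = "path_op \<delta> X m \<phi>"
  show ?case
  proof (cases "m \<in> X")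
    case True
    have "X \<inter> {..<Suc m} = insert m (X \<inter> {..<m})" using True by (auto simp: less_Suc_eq)
    then have c: "card (X \<inter> {..<Suc m}) = Suc (card (X \<inter> {..<m}))" by simp
    have "\<bar>(1 - \<delta>) * (?f (True # y) - ?f (False # y))\<bar> \<le> 1 * (2 * ?B)"
      unfolding abs_mult
      by (rule mult_mono) (use assms Suc.IH[of "True # y"] Suc.IH[of "False # y"] in auto)
    then show ?thesis using True c by (simp add: step_flip_def)
  next
    case False
    have "X \<inter> {..<Suc m} = X \<inter> {..<m}" using False by (auto simp: less_Suc_eq)
    moreover have "\<bar>\<delta> * ?f y + (1 - \<delta>) * ?f (False # y)\<bar> \<le> \<delta> * ?B + (1 - \<delta>) * ?B"
      by (rule order_trans[OF abs_triangle_ineq])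
         (use assms Suc.IH in \<open>auto simp: abs_mult intro!: add_mono mult_left_mono\<close>)
    ultimately show ?thesis using False by (simp add: step_keep_def algebra_simps)
  qed
qed

lemma path_op_translate:
  "path_op \<delta> ((+) s ` Z) (s + m) \<phi> = path_op \<delta> Z m (path_op \<delta> {} s \<phi>)"
proof (induction m)
  case 0
  show ?case using path_op_cong[of s "(+) s ` Z" "{}"] by auto
next
  case (Suc m)
  have "s + m \<in> (+) s ` Z \<longleftrightarrow> m \<in> Z" by auto
  then show ?case using Suc by simp
qed

lemma path_op_append:
  assumes "X \<subseteq> {..<m}"
  shows "path_op \<delta> X (m + r) \<phi> = path_op \<delta> {} r (path_op \<delta> X m \<phi>)"
proof (induction r)
  case (Suc r)
  have "m + r \<notin> X" using assms by auto
  then show ?case using Suc by simp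
qed simp

text \<open>Without corrections only the number \<open>d\<close> of kept zeros matters, and it
  carries binomial weights.\<close>

lemma path_op_empty_eq:
  "path_op \<delta> {} m \<phi> = (\<lambda>y. \<Sum>d\<le>m. (real (m choose d) * (1 - \<delta>) ^ d * \<delta> ^ (m - d)) * \<phi> (replicate d False @ y))"
proof (induction m)
  case (Suc m)
  let ?c = "\<lambda>m d. real (m choose d) * (1 - \<delta>) ^ d * \<delta> ^ (m - d)"
  have "path_op \<delta> {} (Suc m) \<phi> y = (\<Sum>d\<le>Suc m. ?c (Suc m) d * \<phi> (replicate d False @ y))" for y
  proof -
    define g where "g = (\<lambda>d. \<phi> (replicate d False @ y))"
    have g: "\<phi> (replicate d False @ False # y) = g (Suc d)" for d
      unfolding g_def by (simp add: replicate_app_Cons_same)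
    have split: "?c (Suc m) (Suc d) * x = (1 - \<delta>) * (?c m d * x)
        + real (m choose Suc d) * (1 - \<delta>) ^ Suc d * \<delta> ^ (m - d) * x" for d x
      by (simp add: algebra_simps)
    have "\<delta> * (\<Sum>d\<le>m. ?c m d * g d) = (\<Sum>d\<le>m. real (m choose d) * (1 - \<delta>) ^ d * \<delta> ^ (Suc m - d) * g d)"
      unfolding sum_distrib_left by (rule sum.cong) (simp_all add: Suc_diff_le)
    then have shift: "\<delta> * (\<Sum>d\<le>m. ?c m d * g d) =
        (\<Sum>d\<le>Suc m. real (m choose d) * (1 - \<delta>) ^ d * \<delta> ^ (Suc m - d) * g d)"
      by simp
    have "path_op \<delta> {} (Suc m) \<phi> y = \<delta> * (\<Sum>d\<le>m. ?c m d * g d) + (1 - \<delta>) * (\<Sum>d\<le>m. ?c m d * g (Suc d))"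
      by (simp add: step_keep_def Suc.IH g) (simp add: g_def)
    moreover have "(\<Sum>d\<le>Suc m. ?c (Suc m) d * g d) = \<delta> ^ Suc m * g 0 + (\<Sum>d\<le>m. ?c (Suc m) (Suc d) * g (Suc d))"
      by (subst sum.atMost_Suc_shift) simp
    moreover have "\<delta> * (\<Sum>d\<le>m. ?c m d * g d) = \<delta> ^ Suc m * g 0
        + (\<Sum>d\<le>m. real (m choose Suc d) * (1 - \<delta>) ^ Suc d * \<delta> ^ (m - d) * g (Suc d))"
      unfolding shift by (subst sum.atMost_Suc_shift) simp
    ultimately have "path_op \<delta> {} (Suc m) \<phi> y = (\<Sum>d\<le>Suc m. ?c (Suc m) d * g d)"
      by (simp only: split sum.distrib sum_distrib_left[symmetric])
    then show ?thesis by (simp add: g_def)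
  qed
  then show ?case by (rule ext)
qed simp

section \<open>Alternating binomial sums and iterated differences\<close>

definition binsum :: "nat \<Rightarrow> (nat \<Rightarrow> real) \<Rightarrow> real" where
  "binsum L g = (\<Sum>j\<le>L. real (L choose j) * g j)"

lemma binsum_0 [simp]: "binsum 0 g = g 0"
  by (simp add: binsum_def)

lemma binsum_Suc: "binsum (Suc L) g = binsum L g + binsum L (\<lambda>j. g (Suc j))"
proof -
  have "(\<Sum>j\<le>Suc L. real (Suc L choose j) * g j)
      = g 0 + (\<Sum>j\<le>L. real (L choose Suc j) * g (Suc j)) + (\<Sum>j\<le>L. real (L choose j) * g (Suc j))"
    by (subst sum.atMost_Suc_shift) (simp add: sum.distrib algebra_simps)
  also have "g 0 + (\<Sum>j\<le>L. real (L choose Suc j) * g (Suc j)) = (\<Sum>j\<le>Suc L. real (L choose j) * g j)"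
    by (subst sum.atMost_Suc_shift) simp
  finally show ?thesis by (simp add: binsum_def)
qed

lemma binsum_mono: "(\<And>j. j \<le> L \<Longrightarrow> f j \<le> g j) \<Longrightarrow> binsum L f \<le> binsum L g"
  unfolding binsum_def by (intro sum_mono mult_left_mono) auto

lemma binsum_const: "binsum L (\<lambda>_. c) = 2 ^ L * c"
  by (induction L) (auto simp: binsum_Suc)

lemma binsum_mult_left: "binsum L (\<lambda>j. c * f j) = c * binsum L f"
  by (simp add: binsum_def sum_distrib_left mult_ac)

lemma abs_binsum_le: "\<bar>binsum L f\<bar> \<le> binsum L (\<lambda>j. \<bar>f j\<bar>)"
  unfolding binsum_def by (rule order_trans[OF sum_abs]) (simp add: abs_mult)

lemma binsum_add: "binsum (r + L) g = binsum r (\<lambda>t. binsum L (\<lambda>j. g (t + j)))"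
proof (induction r arbitrary: g)
  case (Suc r)
  have "binsum (Suc r + L) g = binsum (r + L) g + binsum (r + L) (\<lambda>j. g (Suc j))"
    by (simp add: binsum_Suc)
  then show ?case using Suc.IH[of g] Suc.IH[of "\<lambda>j. g (Suc j)"] by (simp add: binsum_Suc)
qed simp

fun fdiff :: "nat \<Rightarrow> (nat \<Rightarrow> real) \<Rightarrow> nat \<Rightarrow> real" where
  "fdiff 0 f Y = f Y"
| "fdiff (Suc i) f Y = fdiff i f (Suc Y) - fdiff i f Y"

lemma binsum_alternating: "binsum L (\<lambda>j. (-1) ^ j * f (t + j)) = (-1) ^ L * fdiff L f t"
proof (induction L arbitrary: t)
  case (Suc L)
  have "binsum L (\<lambda>j. (-1) ^ Suc j * f (t + Suc j)) = - binsum L (\<lambda>j. (-1) ^ j * f (Suc t + j))"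
    using binsum_mult_left[of L "-1" "\<lambda>j. (-1) ^ j * f (Suc t + j)"] by simp
  then show ?case using Suc[of t] Suc[of "Suc t"] by (simp add: binsum_Suc algebra_simps)
qed simp

text \<open>Vandermonde splits off the differences of order \<open>l\<close>, so smoothness of \<open>w\<close> is only needed on windows of length \<open>l\<close>.\<close>

lemma alternating_binsum_le:
  assumes "l \<le> L" "\<And>j. j \<le> L \<Longrightarrow> 0 \<le> w j" "0 \<le> \<eta>"
    and "\<And>t. t + l \<le> L \<Longrightarrow> \<exists>j\<le>l. \<not> bad (t + j) \<Longrightarrow>
      \<bar>fdiff l w t\<bar> \<le> \<eta> * binsum l (\<lambda>j. w (t + j))"
  shows "\<bar>binsum L (\<lambda>j. (-1) ^ j * w j)\<bar> \<le> binsum L (\<lambda>j. w j * (\<eta> + of_bool (bad j)))"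
proof -
  define r where "r = L - l"
  have L: "L = r + l" using assms(1) by (simp add: r_def)
  \<comment> \<open>A window with a good point is covered by the assumption on differences. In a
    window of bad points the indicator is 1 throughout, and the triangle inequality
    suffices.\<close>
  have win: "\<bar>fdiff l w t\<bar> \<le> binsum l (\<lambda>j. w (t + j) * (\<eta> + of_bool (bad (t + j))))"
    if t: "t \<le> r" for t
  proof (cases "\<exists>j\<le>l. \<not> bad (t + j)")
    case True
    have "\<bar>fdiff l w t\<bar> \<le> binsum l (\<lambda>j. \<eta> * w (t + j))"
      using assms(4)[OF _ True] t by (simp add: L binsum_mult_left)
    also have "\<dots> \<le> binsum l (\<lambda>j. w (t + j) * (\<eta> + of_bool (bad (t + j))))"
      by (rule binsum_mono) (use t assms(2) L in \<open>simp add: algebra_simps\<close>)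
    finally show ?thesis .
  next
    case False
    have "\<bar>fdiff l w t\<bar> = \<bar>binsum l (\<lambda>j. (-1) ^ j * w (t + j))\<bar>"
      by (simp add: binsum_alternating abs_mult power_abs)
    also have "\<dots> \<le> binsum l (\<lambda>j. \<bar>(-1) ^ j * w (t + j)\<bar>)" by (rule abs_binsum_le)
    also have "\<dots> \<le> binsum l (\<lambda>j. w (t + j) * (\<eta> + of_bool (bad (t + j))))"
      by (rule binsum_mono)
        (use t assms(2,3) L False in \<open>auto simp: abs_mult power_abs algebra_simps\<close>)
    finally show ?thesis .
  qed
  have "\<bar>binsum L (\<lambda>j. (-1) ^ j * w j)\<bar>
      = \<bar>binsum r (\<lambda>t. (-1) ^ t * binsum l (\<lambda>j. (-1) ^ j * w (t + j)))\<bar>"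
    unfolding L binsum_add by (simp add: binsum_mult_left[symmetric] power_add mult_ac)
  also have "\<dots> \<le> binsum r (\<lambda>t. \<bar>fdiff l w t\<bar>)"
    by (rule order_trans[OF abs_binsum_le]) (simp add: binsum_alternating abs_mult power_abs)
  also have "\<dots> \<le> binsum r (\<lambda>t. binsum l (\<lambda>j. w (t + j) * (\<eta> + of_bool (bad (t + j)))))"
    by (rule binsum_mono) (rule win)
  finally show ?thesis by (simp add: L binsum_add)
qed

section \<open>Difference bounds that are stable under products\<close>

text \<open>The moments of a normal variable with mean \<epsilon> and variance \<kappa>, by their
  recurrence of Hermite type. They majorise iterated differences because those of a binomial
  coefficient obey a recurrence of the same shape.\<close>

fun gauss_coeff :: "real \<Rightarrow> real \<Rightarrow> nat \<Rightarrow> real" where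
  "gauss_coeff \<epsilon> \<kappa> 0 = 1"
| "gauss_coeff \<epsilon> \<kappa> (Suc 0) = \<epsilon>"
| "gauss_coeff \<epsilon> \<kappa> (Suc (Suc i)) = \<epsilon> * gauss_coeff \<epsilon> \<kappa> (Suc i) + \<kappa> * real (Suc i) * gauss_coeff \<epsilon> \<kappa> i"

lemma gauss_coeff_Suc:
  "gauss_coeff \<epsilon> \<kappa> (Suc i) = \<epsilon> * gauss_coeff \<epsilon> \<kappa> i + \<kappa> * real i * gauss_coeff \<epsilon> \<kappa> (i - 1)"
  by (cases i) auto

lemma gauss_coeff_nonneg: "0 \<le> \<epsilon> \<Longrightarrow> 0 \<le> \<kappa> \<Longrightarrow> 0 \<le> gauss_coeff \<epsilon> \<kappa> i"
  by (induction \<epsilon> \<kappa> i rule: gauss_coeff.induct) auto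

text \<open>The integer factor in the recurrence is at most \<open>L\<close>, and
  \<open>r = \<epsilon> + q\<close> with \<open>q * q = \<kappa> * L\<close> satisfies
  \<open>\<epsilon> * r + q * q \<le> r * r\<close>, which closes the induction.\<close>

lemma gauss_coeff_le_power:
  assumes "0 \<le> \<epsilon>" "0 \<le> \<kappa>" "i \<le> L"
  shows "gauss_coeff \<epsilon> \<kappa> i \<le> (\<epsilon> + sqrt (\<kappa> * real L)) ^ i"
  using assms
proof (induction \<epsilon> \<kappa> i rule: gauss_coeff.induct)
  case (3 \<epsilon> \<kappa> i)
  define q where "q = sqrt (\<kappa> * real L)"
  define r where "r = \<epsilon> + q"
  have q: "0 \<le> q" "q\<^sup>2 = \<kappa> * real L" using 3 by (auto simp: q_def)
  have r: "0 \<le> r" using q 3 by (simp add: r_def)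
  have "gauss_coeff \<epsilon> \<kappa> (Suc (Suc i)) \<le> \<epsilon> * r ^ Suc i + \<kappa> * real L * r ^ i"
    using 3 r q unfolding q_def r_def gauss_coeff.simps
    by (intro add_mono mult_mono mult_left_mono) (auto simp: gauss_coeff_nonneg)
  also have "\<dots> = r ^ i * (\<epsilon> * r + q * q)" using q by (simp add: algebra_simps power2_eq_square)
  also have "\<dots> \<le> r ^ i * (r * r)"
  proof (rule mult_left_mono)
    have "q * q \<le> q * r" using q 3 by (intro mult_left_mono) (auto simp: r_def)
    then show "\<epsilon> * r + q * q \<le> r * r" by (simp add: r_def algebra_simps)
  qed (use r in simp)
  finally show ?case by (simp add: r_def q_def mult_ac)
qed auto

text \<open>The coefficients have exponential generating function \<open>exp (\<epsilon> t + \<kappa> t\<^sup>2 / 2)\<close>, whence the addition formula.\<close>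

lemma gauss_coeff_add:
  "(\<Sum>l\<le>i. real (i choose l) * gauss_coeff \<epsilon> \<kappa> l * gauss_coeff \<epsilon>' \<kappa>' (i - l))
    = gauss_coeff (\<epsilon> + \<epsilon>') (\<kappa> + \<kappa>') i"
proof (induction i rule: less_induct)
  case (less i)
  let ?a = "gauss_coeff \<epsilon> \<kappa>" and ?b = "gauss_coeff \<epsilon>' \<kappa>'"
  let ?S = "\<lambda>i. \<Sum>l\<le>i. real (i choose l) * ?a l * ?b (i - l)"
  show ?case
  proof (cases i)
    case 0
    then show ?thesis by simp
  next
    case (Suc m)
    have pascal: "?S (Suc m) = (\<Sum>l\<le>m. real (m choose l) * (?a (Suc l) * ?b (m - l) + ?a l * ?b (Suc m - l)))"
    proof -
      have "?S (Suc m) = ?b (Suc m) + (\<Sum>l\<le>m. real (m choose Suc l) * ?a (Suc l) * ?b (m - l))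
          + (\<Sum>l\<le>m. real (m choose l) * ?a (Suc l) * ?b (m - l))"
        by (subst sum.atMost_Suc_shift) (simp add: sum.distrib algebra_simps)
      also have "?b (Suc m) + (\<Sum>l\<le>m. real (m choose Suc l) * ?a (Suc l) * ?b (m - l))
          = (\<Sum>l\<le>Suc m. real (m choose l) * ?a l * ?b (Suc m - l))"
        by (subst sum.atMost_Suc_shift) simp
      finally show ?thesis by (simp add: sum.distrib algebra_simps)
    qed
    show ?thesis
    proof (cases m)
      case 0
      then show ?thesis using Suc pascal by simp
    next
      case (Suc m')
      have low: "(\<Sum>l\<le>m. real (m choose l) * (real l * ?a (l - 1) * ?b (m - l))) = real m * ?S m'"
      proof -
        have "(\<Sum>l\<le>m. real (m choose l) * (real l * ?a (l - 1) * ?b (m - l)))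
            = (\<Sum>l\<le>m'. real ((Suc m' choose Suc l) * Suc l) * ?a l * ?b (m' - l))"
          unfolding Suc by (subst sum.atMost_Suc_shift) (simp add: mult_ac del: binomial_Suc_Suc of_nat_Suc mult_Suc_right mult_Suc)
        also have "\<dots> = (\<Sum>l\<le>m'. real (Suc m' * (m' choose l)) * ?a l * ?b (m' - l))"
          by (simp only: Suc_times_binomial_eq)
        finally show ?thesis
          unfolding Suc by (simp only: sum_distrib_left of_nat_mult mult.assoc)
      qed
      have high: "(\<Sum>l\<le>m. real (m choose l) * (real (m - l) * ?a l * ?b (m - l - 1))) = real m * ?S m'"
      proof -
        have "(\<Sum>l\<le>m. real (m choose l) * (real (m - l) * ?a l * ?b (m - l - 1)))
            = (\<Sum>l\<le>m'. real ((Suc m' choose l) * (Suc m' - l)) * ?a l * ?b (m' - l))"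
          unfolding Suc by (simp add: mult_ac del: of_nat_Suc)
        also have "\<dots> = (\<Sum>l\<le>m'. real (Suc m' * (m' choose l)) * ?a l * ?b (m' - l))"
        proof (rule sum.cong)
          fix l assume "l \<in> {..m'}"
          then have "(Suc m' choose l) * (Suc m' - l) = Suc m' * (m' choose l)"
            using binomial_absorb_comp[of "Suc m'" l] by (simp add: mult_ac)
          then show "real ((Suc m' choose l) * (Suc m' - l)) * ?a l * ?b (m' - l)
              = real (Suc m' * (m' choose l)) * ?a l * ?b (m' - l)" by simp
        qed simp
        finally show ?thesis
          unfolding Suc by (simp only: sum_distrib_left of_nat_mult mult.assoc)
      qed
      have "?S (Suc m) = (\<Sum>l\<le>m. real (m choose l) *
          ((\<epsilon> * ?a l + \<kappa> * real l * ?a (l - 1)) * ?b (m - l)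
           + ?a l * (\<epsilon>' * ?b (m - l) + \<kappa>' * real (m - l) * ?b (m - l - 1))))"
        unfolding pascal
        by (rule sum.cong) (simp_all add: gauss_coeff_Suc Suc_diff_le)
      also have "\<dots> = (\<epsilon> + \<epsilon>') * ?S m
          + \<kappa> * (\<Sum>l\<le>m. real (m choose l) * (real l * ?a (l - 1) * ?b (m - l)))
          + \<kappa>' * (\<Sum>l\<le>m. real (m choose l) * (real (m - l) * ?a l * ?b (m - l - 1)))"
        unfolding sum_distrib_left sum.distrib[symmetric]
        by (rule sum.cong) (simp_all add: algebra_simps)
      also have "\<dots> = (\<epsilon> + \<epsilon>') * ?S m + (\<kappa> + \<kappa>') * real m * ?S m'"
        unfolding low high by (simp add: algebra_simps)
      finally show ?thesis
        using less[of m] less[of m'] \<open>i = Suc m\<close> Suc by (simp del: of_nat_Suc)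
    qed
  qed
qed

text \<open>The discrete Leibniz rule. The shift of the second factor by \<open>l\<close> is why
  \<open>tame\<close> bounds differences at every point of the window.\<close>

lemma fdiff_mult:
  "fdiff i (\<lambda>Y. f Y * g Y) t = (\<Sum>l\<le>i. real (i choose l) * fdiff l f t * fdiff (i - l) g (t + l))"
proof (induction i arbitrary: t)
  case (Suc i)
  let ?a = "\<lambda>l t. fdiff l f t" and ?b = "\<lambda>l t. fdiff l g t"
  have "(\<Sum>l\<le>Suc i. real (Suc i choose l) * ?a l t * ?b (Suc i - l) (t + l))
      = ?a 0 t * ?b (Suc i) t + (\<Sum>l\<le>i. real (i choose Suc l) * ?a (Suc l) t * ?b (i - l) (t + Suc l))
        + (\<Sum>l\<le>i. real (i choose l) * ?a (Suc l) t * ?b (i - l) (t + Suc l))"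
    by (subst sum.atMost_Suc_shift)
      (simp only: binomial_Suc_Suc of_nat_add distrib_right sum.distrib, simp)
  moreover have "?a 0 t * ?b (Suc i) t + (\<Sum>l\<le>i. real (i choose Suc l) * ?a (Suc l) t * ?b (i - l) (t + Suc l))
      = (\<Sum>l\<le>Suc i. real (i choose l) * ?a l t * ?b (Suc i - l) (t + l))"
    by (subst sum.atMost_Suc_shift) simp
  moreover have "\<dots> = (\<Sum>l\<le>i. real (i choose l) * ?a l t * ?b (Suc (i - l)) (t + l))"
    by (simp add: Suc_diff_le)
  moreover have "fdiff (Suc i) (\<lambda>Y. f Y * g Y) t =
      (\<Sum>l\<le>i. real (i choose l) * ?a l (Suc t) * ?b (i - l) (Suc t + l))
      - (\<Sum>l\<le>i. real (i choose l) * ?a l t * ?b (i - l) (t + l))"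
    by (simp add: Suc)
  moreover have "\<dots> = (\<Sum>l\<le>i. real (i choose l) * ?a (Suc l) t * ?b (i - l) (t + Suc l))
      + (\<Sum>l\<le>i. real (i choose l) * ?a l t * ?b (Suc (i - l)) (t + l))"
    unfolding sum.distrib[symmetric] sum_subtractf[symmetric]
    by (rule sum.cong) (simp_all add: algebra_simps)
  ultimately show ?case by linarith
qed simp

text \<open>\<open>c\<close> normalises the size of \<open>f\<close>. Majorised differences together
  with a lower bound form a class closed under products, with \<epsilon> and \<kappa> additive. The
  2 in the lower exponent comes from
  \<open>exp (- 2 * \<epsilon>) \<le> 1 - \<epsilon>\<close>.\<close>

definition tame :: "nat \<Rightarrow> real \<Rightarrow> real \<Rightarrow> (nat \<Rightarrow> real) \<Rightarrow> bool" where
  "tame L \<epsilon> \<kappa> f \<longleftrightarrow> 0 \<le> \<epsilon> \<and> 0 \<le> \<kappa> \<and> (\<exists>c>0.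
     (\<forall>i Y. i + Y \<le> L \<longrightarrow> \<bar>fdiff i f Y\<bar> \<le> c * exp (\<epsilon> * real L) * gauss_coeff \<epsilon> \<kappa> i) \<and>
     (\<forall>Y\<le>L. c * exp (- 2 * \<epsilon> * real L) \<le> f Y))"

lemma fdiff_one: "fdiff i (\<lambda>_. 1) Y = of_bool (i = 0)"
  by (induction i arbitrary: Y) auto

lemma tame_one: "0 \<le> \<epsilon> \<Longrightarrow> 0 \<le> \<kappa> \<Longrightarrow> tame L \<epsilon> \<kappa> (\<lambda>_. 1)"
  unfolding tame_def by (auto intro!: exI[of _ 1] simp: fdiff_one gauss_coeff_nonneg)

text \<open>The Leibniz rule turns two majorants into the binomial convolution evaluated by
  \<open>gauss_coeff_add\<close>, just as independent normal variables add.\<close>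

lemma tame_mult:
  assumes "tame L \<epsilon> \<kappa> f" "tame L \<epsilon>' \<kappa>' g"
  shows "tame L (\<epsilon> + \<epsilon>') (\<kappa> + \<kappa>') (\<lambda>Y. f Y * g Y)"
proof -
  obtain c where c: "c > 0"
    "\<And>i Y. i + Y \<le> L \<Longrightarrow> \<bar>fdiff i f Y\<bar> \<le> c * exp (\<epsilon> * real L) * gauss_coeff \<epsilon> \<kappa> i"
    "\<And>Y. Y \<le> L \<Longrightarrow> c * exp (- 2 * \<epsilon> * real L) \<le> f Y"
    using assms(1) unfolding tame_def by blast
  obtain d where d: "d > 0"
    "\<And>i Y. i + Y \<le> L \<Longrightarrow> \<bar>fdiff i g Y\<bar> \<le> d * exp (\<epsilon>' * real L) * gauss_coeff \<epsilon>' \<kappa>' i"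
    "\<And>Y. Y \<le> L \<Longrightarrow> d * exp (- 2 * \<epsilon>' * real L) \<le> g Y"
    using assms(2) unfolding tame_def by blast
  have nn: "0 \<le> \<epsilon>" "0 \<le> \<kappa>" "0 \<le> \<epsilon>'" "0 \<le> \<kappa>'" using assms by (auto simp: tame_def)
  show ?thesis
    unfolding tame_def
  proof (intro conjI exI[of _ "c * d"] allI impI)
    fix i Y assume iY: "i + Y \<le> L"
    have "\<bar>fdiff i (\<lambda>Y. f Y * g Y) Y\<bar>
        \<le> (\<Sum>l\<le>i. real (i choose l) * \<bar>fdiff l f Y\<bar> * \<bar>fdiff (i - l) g (Y + l)\<bar>)"
      unfolding fdiff_mult by (rule order_trans[OF sum_abs]) (simp add: abs_mult)
    also have "\<dots> \<le> (\<Sum>l\<le>i. real (i choose l) * (c * exp (\<epsilon> * real L) * gauss_coeff \<epsilon> \<kappa> l)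
        * (d * exp (\<epsilon>' * real L) * gauss_coeff \<epsilon>' \<kappa>' (i - l)))"
      by (intro sum_mono mult_mono mult_left_mono c d mult_nonneg_nonneg gauss_coeff_nonneg)
        (use iY nn c(1) d(1) in auto)
    also have "\<dots> = (c * d * (exp (\<epsilon> * real L) * exp (\<epsilon>' * real L))) *
       (\<Sum>l\<le>i. real (i choose l) * gauss_coeff \<epsilon> \<kappa> l * gauss_coeff \<epsilon>' \<kappa>' (i - l))"
      unfolding sum_distrib_left by (rule sum.cong) (simp_all add: mult_ac)
    also have "\<dots> = c * d * exp ((\<epsilon> + \<epsilon>') * real L) * gauss_coeff (\<epsilon> + \<epsilon>') (\<kappa> + \<kappa>') i"
      by (simp add: gauss_coeff_add exp_add[symmetric] distrib_right)
    finally show "\<bar>fdiff i (\<lambda>Y. f Y * g Y) Y\<bar>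
        \<le> c * d * exp ((\<epsilon> + \<epsilon>') * real L) * gauss_coeff (\<epsilon> + \<epsilon>') (\<kappa> + \<kappa>') i" .
  next
    fix Y assume Y: "Y \<le> L"
    have "c * d * exp (- 2 * (\<epsilon> + \<epsilon>') * real L)
        = (c * exp (- 2 * \<epsilon> * real L)) * (d * exp (- 2 * \<epsilon>' * real L))"
      by (simp add: exp_add[symmetric] algebra_simps)
    also have "\<dots> \<le> f Y * g Y"
      using c(1) d(1) c(3)[OF Y] d(3)[OF Y]
      by (intro mult_mono) (auto intro: order_trans[rotated])
    finally show "c * d * exp (- 2 * (\<epsilon> + \<epsilon>') * real L) \<le> f Y * g Y" .
  qed (use nn c d in auto)
qed

lemma tame_prod:
  assumes "finite A" "\<And>z. z \<in> A \<Longrightarrow> tame L (\<epsilon> z) (\<kappa> z) (f z)"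
  shows "tame L (\<Sum>z\<in>A. \<epsilon> z) (\<Sum>z\<in>A. \<kappa> z) (\<lambda>Y. \<Prod>z\<in>A. f z Y)"
  using assms by (induction A rule: finite_induct) (auto simp: tame_one tame_mult)

text \<open>The difference is at most \<open>c * exp (\<epsilon> * L) * r ^ L\<close> with
  \<open>r = \<epsilon> + sqrt (\<kappa> * L)\<close>, while the binomial sum is at least
  \<open>2 ^ L * c * exp (- 2 * \<epsilon> * L)\<close>. The assumption \<open>small\<close> makes
  the quotient at most \<open>exp (- L)\<close>.\<close>

lemma tame_fdiff_le:
  assumes "tame L \<epsilon> \<kappa> f"
    and small: "exp (3 * \<epsilon>) * (\<epsilon> + sqrt (\<kappa> * real L)) \<le> 2 * exp (- 1)"
  shows "\<bar>fdiff L f 0\<bar> \<le> exp (- real L) * binsum L f"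
proof -
  obtain c where c: "c > 0"
    "\<And>i Y. i + Y \<le> L \<Longrightarrow> \<bar>fdiff i f Y\<bar> \<le> c * exp (\<epsilon> * real L) * gauss_coeff \<epsilon> \<kappa> i"
    "\<And>Y. Y \<le> L \<Longrightarrow> c * exp (- 2 * \<epsilon> * real L) \<le> f Y"
    using assms(1) unfolding tame_def by blast
  have nn: "0 \<le> \<epsilon>" "0 \<le> \<kappa>" using assms(1) by (auto simp: tame_def)
  let ?r = "\<epsilon> + sqrt (\<kappa> * real L)"
  have "\<bar>fdiff L f 0\<bar> \<le> c * exp (\<epsilon> * real L) * ?r ^ L"
    using c(2)[of L 0] gauss_coeff_le_power[OF nn, of L L] c(1)
    by (smt (verit) add.right_neutral exp_gt_zero mult_left_mono mult_pos_pos order_refl)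
  also have "\<dots> = c * exp (- 2 * \<epsilon> * real L) * (exp (3 * \<epsilon>) * ?r) ^ L"
  proof -
    have "exp (- 2 * \<epsilon> * real L) * exp (3 * \<epsilon>) ^ L = exp (\<epsilon> * real L)"
      by (simp add: exp_of_nat_mult[symmetric] exp_add[symmetric] algebra_simps)
    then show ?thesis by (simp add: power_mult_distrib mult.assoc)
  qed
  also have "\<dots> \<le> c * exp (- 2 * \<epsilon> * real L) * (2 * exp (- 1)) ^ L"
    using c(1) nn by (intro mult_left_mono power_mono small) auto
  also have "\<dots> = exp (- real L) * (2 ^ L * (c * exp (- 2 * \<epsilon> * real L)))"
    by (simp add: power_mult_distrib exp_of_nat_mult[symmetric])
  also have "\<dots> \<le> exp (- real L) * binsum L f"
    unfolding binsum_const[symmetric] by (intro mult_left_mono binsum_mono c) auto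
  finally show ?thesis .
qed

section \<open>Iterated differences of binomial coefficients\<close>

lemma binomial_step_real:
  "(real a + 1) * real (N choose Suc a) = (real N - real a) * real (N choose a)"
proof (cases "a \<le> N")
  case True
  have "Suc a * (N choose Suc a) = (N - a) * (N choose a)"
    by (simp only: binomial_absorption binomial_absorb_comp)
  then have "real (Suc a * (N choose Suc a)) = real ((N - a) * (N choose a))" by (simp only:)
  then show ?thesis using True by (simp add: of_nat_diff algebra_simps)
qed (simp add: binomial_eq_0)

text \<open>The ratio of neighbouring binomial coefficients is a first-order difference equation
  with coefficients linear in \<open>Y\<close>, so differencing it repeatedly leaves only three
  terms. For \<open>i = 0\<close> the truncated index is harmless, since the last term has the
  factor \<open>i\<close>.\<close>

lemma fdiff_binomial:
  fixes N x :: nat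
  defines "f \<equiv> \<lambda>Y. real (N choose (x + Y))"
  shows "(real (x + Y + 1) + real i) * fdiff (Suc i) f Y
    = (real N - 2 * real (x + Y) - 1 - real i) * fdiff i f Y - 2 * real i * fdiff (i - 1) f (Suc Y)"
proof (induction i arbitrary: Y)
  case 0
  show ?case using binomial_step_real[of "x + Y" N] by (simp add: f_def algebra_simps)
next
  case (Suc i)
  define u v where "u = real (x + Y + 1) + real i" and "v = real N - 2 * real (x + Y) - 1 - real i"
  have 1: "(u + 1) * (fdiff (Suc i) f (Suc Y)) = (v - 2) * fdiff i f (Suc Y) - 2 * real i * fdiff (i - 1) f (Suc (Suc Y))"
    using Suc[of "Suc Y"] by (simp add: u_def v_def algebra_simps)
  have 2: "u * (fdiff (Suc i) f Y) = v * fdiff i f Y - 2 * real i * fdiff (i - 1) f (Suc Y)"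
    using Suc[of Y] by (simp add: u_def v_def algebra_simps)
  have 3: "real i * fdiff (i - 1) f (Suc (Suc Y)) = real i * fdiff (i - 1) f (Suc Y) + real i * fdiff i f (Suc Y)"
    by (cases i) (auto simp: algebra_simps)
  have "(u + 1) * (fdiff (Suc i) f (Suc Y) - fdiff (Suc i) f Y)
     = (v - 1) * fdiff (Suc i) f Y - 2 * real (Suc i) * fdiff i f (Suc Y)"
    using 1 2 3 by (simp add: algebra_simps)
  then show ?case by (simp add: u_def v_def algebra_simps)
qed

text \<open>After division by the leading coefficient, \<open>fdiff_binomial\<close> is dominated by
  \<open>gauss_coeff_Suc\<close>: the last assumption supplies \<epsilon> and
  \<open>2 \<le> \<kappa> * U\<close> supplies \<kappa>. The summand \<open>real L\<close> absorbs
  the order of the difference, which appears in the middle coefficient.\<close>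

lemma tame_binomial:
  fixes N x L :: nat
  assumes "0 \<le> \<epsilon>" "\<epsilon> \<le> 1/2" "0 \<le> \<kappa>" "0 < U" "x \<le> N" "2 \<le> \<kappa> * U"
    and u: "\<And>Y. Y \<le> L \<Longrightarrow> U \<le> real (x + Y + 1)"
    and v: "\<And>Y. Y \<le> L \<Longrightarrow> \<bar>real N - 2 * real (x + Y) - 1\<bar> + real L \<le> \<epsilon> * U"
  shows "tame L \<epsilon> \<kappa> (\<lambda>Y. real (N choose (x + Y)))"
proof -
  define f where "f = (\<lambda>Y. real (N choose (x + Y)))"
  define c where "c = f 0"
  have c: "c > 0" using assms by (simp add: c_def f_def)
  have ratio: "(1 - \<epsilon>) * f Y \<le> f (Suc Y) \<and> f (Suc Y) \<le> (1 + \<epsilon>) * f Y" if Y: "Y < L" for Y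
  proof -
    let ?u = "real (x + Y + 1)"
    have u0: "U \<le> ?u" "0 < ?u" using u[of Y] Y assms by auto
    have e: "?u * (f (Suc Y) - f Y) = (real N - 2 * real (x + Y) - 1) * f Y"
      using fdiff_binomial[of x Y 0 N] by (simp add: f_def)
    have "\<bar>real N - 2 * real (x + Y) - 1\<bar> \<le> \<epsilon> * ?u"
      using v[of Y] Y u0 mult_left_mono[OF u0(1) assms(1)] by linarith
    moreover have "0 \<le> f Y" by (simp add: f_def)
    ultimately have "\<bar>?u * (f (Suc Y) - f Y)\<bar> \<le> \<epsilon> * ?u * f Y"
      unfolding e abs_mult by (simp add: mult_right_mono)
    then have "?u * \<bar>f (Suc Y) - f Y\<bar> \<le> ?u * (\<epsilon> * f Y)"
      using u0 by (simp add: abs_mult mult_ac)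
    then have "\<bar>f (Suc Y) - f Y\<bar> \<le> \<epsilon> * f Y" using u0 mult_le_cancel_left_pos by blast
    then show ?thesis by (auto simp: algebra_simps abs_le_iff)
  qed
  have up: "f Y \<le> c * exp (\<epsilon> * real Y)" if "Y \<le> L" for Y
    using that
  proof (induction Y)
    case (Suc Y)
    have "f (Suc Y) \<le> (1 + \<epsilon>) * f Y" using ratio[of Y] Suc by auto
    also have "\<dots> \<le> exp \<epsilon> * (c * exp (\<epsilon> * real Y))"
      using Suc by (intro mult_mono exp_ge_add_one_self) (auto simp: f_def)
    finally show ?case by (simp add: exp_add algebra_simps)
  qed (simp add: c_def)
  have low: "c * exp (- 2 * \<epsilon> * real Y) \<le> f Y" if "Y \<le> L" for Y
    using that
  proof (induction Y)
    case (Suc Y)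
    \<comment> \<open>This is where \<epsilon> \<le> 1/2 enters.\<close>
    have "exp (- 2 * \<epsilon>) \<le> 1 - \<epsilon>"
    proof -
      have "0 \<le> \<epsilon> * (1 - 2 * \<epsilon>)" using assms(1,2) by simp
      then have "1 \<le> (1 - \<epsilon>) * (1 + 2 * \<epsilon>)" by (simp add: algebra_simps)
      also have "\<dots> \<le> (1 - \<epsilon>) * exp (2 * \<epsilon>)"
        using assms by (intro mult_left_mono exp_ge_add_one_self) auto
      finally show ?thesis by (simp add: exp_minus field_simps)
    qed
    then have "exp (- 2 * \<epsilon>) * (c * exp (- 2 * \<epsilon> * real Y)) \<le> (1 - \<epsilon>) * f Y"
      using Suc c assms by (intro mult_mono) auto
    also have "\<dots> \<le> f (Suc Y)" using ratio[of Y] Suc by auto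
    finally show ?case by (simp add: exp_add[symmetric] algebra_simps)
  qed (simp add: c_def)
  have diff: "\<bar>fdiff i f Y\<bar> \<le> c * exp (\<epsilon> * real L) * gauss_coeff \<epsilon> \<kappa> i" if "i + Y \<le> L" for i Y
    using that
  proof (induction i arbitrary: Y rule: less_induct)
    case (less i)
    let ?C = "c * exp (\<epsilon> * real L)"
    let ?b = "gauss_coeff \<epsilon> \<kappa>"
    have C: "?C \<ge> 0" using c by simp
    show ?case
    proof (cases i)
      case 0
      have "\<bar>f Y\<bar> \<le> c * exp (\<epsilon> * real Y)" using up[of Y] less 0 by (simp add: f_def)
      also have "\<dots> \<le> ?C" using less 0 c assms by (simp add: mult_left_mono)
      finally show ?thesis using 0 by simp
    next
      case (Suc m)
      let ?u = "real (x + Y + 1) + real m" and ?v = "real N - 2 * real (x + Y) - 1 - real m"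
      have Y: "Y \<le> L" "m \<le> L" "m + Y \<le> L" using less Suc by auto
      have u0: "U \<le> ?u" "0 < ?u" using u[OF Y(1)] assms by auto
      have "\<bar>?v\<bar> \<le> \<epsilon> * ?u"
        using v[OF Y(1)] Y mult_left_mono[OF u0(1) assms(1)] by linarith
      moreover have "2 \<le> \<kappa> * ?u" using mult_left_mono[OF u0(1) assms(3)] assms by linarith
      moreover have d1: "\<bar>fdiff m f Y\<bar> \<le> ?C * ?b m" using less.IH[of m Y] Suc Y by auto
      moreover have d2: "real m * \<bar>fdiff (m - 1) f (Suc Y)\<bar> \<le> real m * (?C * ?b (m - 1))"
        using less.IH[of "m - 1" "Suc Y"] Suc Y by (cases m) (auto intro!: mult_left_mono)
      moreover have b: "0 \<le> ?b j" for j using assms by (simp add: gauss_coeff_nonneg)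
      moreover have "0 \<le> \<epsilon> * ?u" "0 \<le> \<kappa> * ?u" using assms u0 by auto
      moreover have "0 \<le> real m * \<bar>fdiff (m - 1) f (Suc Y)\<bar>" by simp
      ultimately have "\<bar>?v\<bar> * \<bar>fdiff m f Y\<bar> + 2 * (real m * \<bar>fdiff (m - 1) f (Suc Y)\<bar>)
          \<le> (\<epsilon> * ?u) * (?C * ?b m) + (\<kappa> * ?u) * (real m * (?C * ?b (m - 1)))"
        using C by (intro add_mono[OF mult_mono mult_mono]) simp_all
      moreover have "\<bar>?u * fdiff (Suc m) f Y\<bar> \<le> \<bar>?v\<bar> * \<bar>fdiff m f Y\<bar> + 2 * (real m * \<bar>fdiff (m - 1) f (Suc Y)\<bar>)"
        unfolding f_def fdiff_binomial
        by (rule order_trans[OF abs_triangle_ineq4]) (simp add: abs_mult)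
      moreover have "\<bar>?u * fdiff (Suc m) f Y\<bar> = ?u * \<bar>fdiff (Suc m) f Y\<bar>"
        unfolding abs_mult using u0 by (simp only: abs_of_pos)
      moreover have "(\<epsilon> * ?u) * (?C * ?b m) + (\<kappa> * ?u) * (real m * (?C * ?b (m - 1))) = ?u * (?C * ?b (Suc m))"
        unfolding gauss_coeff_Suc by (simp only: distrib_left mult_ac)
      ultimately have "?u * \<bar>fdiff (Suc m) f Y\<bar> \<le> ?u * (?C * ?b (Suc m))"
        by linarith
      then show ?thesis using u0 Suc mult_le_cancel_left_pos by blast
    qed
  qed
  have "c * exp (- 2 * \<epsilon> * real L) \<le> f Y" if "Y \<le> L" for Y
  proof -
    have "c * exp (- 2 * \<epsilon> * real L) \<le> c * exp (- 2 * \<epsilon> * real Y)"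
      using that c assms by (simp add: mult_left_mono)
    then show ?thesis using low[OF that] by linarith
  qed
  then show ?thesis
    unfolding tame_def using assms c diff by (auto simp: f_def intro!: exI[of _ c])
qed

section \<open>Alternating sums over translates\<close>

text \<open>The 1 counts elements and the fraction measures the distance from n/2 on the scale
  \<open>sqrt n\<close>, so a single threshold controls the number of factors and their total
  deviation. Being additive, it has an exponential that factorises over \<open>X\<close>.\<close>

definition spread :: "nat \<Rightarrow> nat set \<Rightarrow> real" where
  "spread n X = (\<Sum>x\<in>X. 1 + \<bar>2 * real x - real n\<bar> / sqrt (real n))"

lemma fdiff_shift: "fdiff i (\<lambda>Y. f (t + Y)) Y = fdiff i f (t + Y)"
  by (induction i arbitrary: Y) auto

text \<open>The factorials in \<open>(s choose d\<^sub>0) * (M - s choose d\<^sub>1)\<close> turn the two extreme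
  factors of \<open>\<Prod>z\<in>Z. n choose (z + s)\<close> into one binomial weight times a single binomial
  coefficient; this is the first factor below.\<close>

definition smooth_part :: "nat \<Rightarrow> nat set \<Rightarrow> nat \<Rightarrow> real" where
  "smooth_part n Z t = (if Max Z = 0 then 1 else real ((n + Max Z) choose (Max Z + t)))
     * (\<Prod>z\<in>Z - {0, Max Z}. real (n choose (z + t)))"

lemma spread_translate:
  "spread n ((+) s ` Z) = (\<Sum>z\<in>Z. 1 + \<bar>2 * real (s + z) - real n\<bar> / sqrt (real n))"
  unfolding spread_def by (subst sum.reindex) (auto simp: inj_on_def)

text \<open>One point \<open>s + j\<close> of small spread controls the whole window, as moving by
  at most \<open>l\<close> changes each deviation by at most \<open>2 * l\<close>. All factors are
  then tame, the parameters add up to \<epsilon> \<le> 1/40 and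
  \<open>\<kappa> * l \<le> 1/100\<close>, and \<open>tame_fdiff_le\<close> applies.\<close>

lemma fdiff_smooth_part_le:
  assumes Z: "finite Z" "0 \<in> Z" and n: "10000 \<le> n" and l: "real l \<le> sqrt (real n)"
    and range: "Max Z + s + l \<le> n" and j: "j \<le> l"
    and spr: "spread n ((+) (s + j) ` Z) \<le> sqrt (real n) / 800"
  shows "\<bar>fdiff l (smooth_part n Z) s\<bar> \<le> exp (- real l) * binsum l (\<lambda>i. smooth_part n Z (s + i))"
proof -
  define G where "G = Max Z"
  define r where "r = sqrt (real n)"
  define dev where "dev z = \<bar>2 * real (s + j + z) - real n\<bar>" for z
  \<comment> \<open>Chosen so that \<open>e z * (n / 4)\<close> is \<open>dev z + 3 * l + 1\<close>:
    \<open>2 * l\<close> for moving inside the window, \<open>l\<close> for the slack in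
    \<open>tame_binomial\<close>, 1 for its off-centre term. The bound \<open>U\<close> is n/4
    throughout.\<close>
  define e where "e z = 4 * (dev z + 3 * real l + 1) / real n" for z
  have mx: "Max Z \<in> Z" by (rule Max_in) (use Z in auto)
  have G: "G \<in> Z" "\<And>z. z \<in> Z \<Longrightarrow> z \<le> G" using Z mx by (auto simp: G_def)
  have rn: "r * r = real n" "0 < r" using n by (auto simp: r_def)
  have r100: "100 \<le> r" unfolding r_def by (rule real_le_rsqrt) (use n in simp)
  have rle: "100 * r \<le> real n" using mult_right_mono[OF r100, of r] rn by simp
  have npos: "0 < real n" using n by simp
  have spr': "real (card Z) + (\<Sum>z\<in>Z. dev z) / r \<le> r / 800"
    using spr unfolding spread_translate
    by (simp add: sum.distrib dev_def r_def sum_divide_distrib)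
  have devn: "0 \<le> dev z" for z by (simp add: dev_def)
  have card: "real (card Z) \<le> r / 800"
    using spr' rn by (smt (verit) devn divide_nonneg_pos sum_nonneg)
  have sumdev: "(\<Sum>z\<in>Z. dev z) \<le> real n / 800"
  proof -
    have "(\<Sum>z\<in>Z. dev z) / r \<le> r / 800" using spr' by (smt (verit) of_nat_0_le_iff)
    then have "(\<Sum>z\<in>Z. dev z) \<le> r / 800 * r" using rn by (simp add: pos_divide_le_eq)
    then show ?thesis using rn by simp
  qed
  have dev_le: "dev z \<le> real n / 800" if "z \<in> Z" for z
    using member_le_sum[OF that, of dev] devn Z sumdev by force
  have lr: "real l \<le> r" using l by (simp add: r_def)
  have e_nonneg: "0 \<le> e z" for z using devn[of z] by (simp add: e_def)
  have eU: "e z * (real n / 4) = dev z + 3 * real l + 1" for z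
    using npos by (simp add: e_def)
  have e_small: "e z \<le> 1 / 4" if "z \<in> Z" for z
  proof -
    have "4 * (dev z + 3 * real l + 1) \<le> 1/4 * real n"
      using dev_le[OF that] lr rle r100 by argo
    then show ?thesis using npos by (simp add: e_def pos_divide_le_eq)
  qed
  have base: "real n / 4 \<le> real (z + s + Y + 1)" if "z \<in> Z" for z Y
  proof -
    have "- (2 * real (s + j + z) - real n) \<le> real n / 800"
      using dev_le[OF that, unfolded dev_def] by (rule order_trans[OF abs_ge_minus_self])
    moreover have "real j \<le> real l" using j by simp
    ultimately show ?thesis using lr rle by simp
  qed
  have single: "tame l (e z) (8 / real n) (\<lambda>Y. real (n choose (z + s + Y)))" if z: "z \<in> Z" for z
  proof (rule tame_binomial[where U = "real n / 4"])
    show "z + s \<le> n" using range G(2)[OF z] by (simp add: G_def)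
    show "\<bar>real n - 2 * real (z + s + Y) - 1\<bar> + real l \<le> e z * (real n / 4)" if "Y \<le> l" for Y
      unfolding eU using that j by (auto simp: dev_def)
  qed (use e_nonneg[of z] e_small[OF z] npos base[OF z] in auto)
  \<comment> \<open>The centre of the joint coefficient involves the mean of the deviations at 0 and
    \<open>G\<close>, so its parameters can be charged to these two elements; 16/n is twice
    8/n.\<close>
  have outer: "tame l (\<Sum>z\<in>{0, G}. e z) (\<Sum>z\<in>{0, G}. 8 / real n)
      (\<lambda>Y. if G = 0 then 1 else real ((n + G) choose (G + s + Y)))"
  proof (cases "G = 0")
    case True
    then show ?thesis using e_nonneg npos by (simp add: tame_one)
  next
    case False
    have "tame l (e 0 + e G) (16 / real n) (\<lambda>Y. real ((n + G) choose (G + s + Y)))"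
    proof (rule tame_binomial[where U = "real n / 4"])
      show "G + s \<le> n + G" using range by (simp add: G_def)
      show "\<bar>real (n + G) - 2 * real (G + s + Y) - 1\<bar> + real l \<le> (e 0 + e G) * (real n / 4)" if "Y \<le> l" for Y
        unfolding distrib_right eU using that j by (auto simp: dev_def)
    qed (use e_nonneg[of 0] e_nonneg[of G] e_small[OF Z(2)] e_small[OF G(1)] npos base[OF G(1)] in auto)
    then show ?thesis using False by simp
  qed
  have sub: "{0, G} \<subseteq> Z" using Z G by auto
  define \<epsilon> where "\<epsilon> = (\<Sum>z\<in>Z. e z)"
  define \<kappa> where "\<kappa> = real (card Z) * (8 / real n)"
  have "tame l ((\<Sum>z\<in>{0, G}. e z) + (\<Sum>z\<in>Z - {0, G}. e z))
      ((\<Sum>z\<in>{0, G}. 8 / real n) + (\<Sum>z\<in>Z - {0, G}. 8 / real n))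
      (\<lambda>Y. (if G = 0 then 1 else real ((n + G) choose (G + (s + Y))))
        * (\<Prod>z\<in>Z - {0, G}. real (n choose (z + (s + Y)))))"
    unfolding add.assoc[symmetric] by (rule tame_mult[OF outer tame_prod]) (use Z single in auto)
  moreover have "(\<Sum>z\<in>{0, G}. e z) + (\<Sum>z\<in>Z - {0, G}. e z) = \<epsilon>"
    unfolding \<epsilon>_def using sum.subset_diff[OF sub Z(1), of e] by simp
  moreover have "(\<Sum>z\<in>{0, G}. 8 / real n) + (\<Sum>z\<in>Z - {0, G}. 8 / real n) = \<kappa>"
    unfolding \<kappa>_def using sum.subset_diff[OF sub Z(1), of "\<lambda>_. 8 / real n"] by simp
  ultimately have tame: "tame l \<epsilon> \<kappa> (\<lambda>Y. smooth_part n Z (s + Y))"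
    unfolding smooth_part_def G_def[symmetric] by (simp only:)
  have eps: "\<epsilon> \<le> 1 / 40"
  proof -
    have "\<epsilon> = 4 * (\<Sum>z\<in>Z. dev z + 3 * real l + 1) / real n"
      unfolding \<epsilon>_def e_def sum_divide_distrib[symmetric] sum_distrib_left[symmetric] ..
    then have "\<epsilon> * real n = 4 * (\<Sum>z\<in>Z. dev z + 3 * real l + 1)" using npos by simp
    also have "\<dots> = 4 * ((\<Sum>z\<in>Z. dev z) + real (card Z) * (3 * real l + 1))"
      by (simp add: sum.distrib algebra_simps)
    also have "real (card Z) * (3 * real l + 1) \<le> r / 800 * (4 * r)"
      using card lr r100 by (intro mult_mono) auto
    finally have "\<epsilon> * real n \<le> 4 * (real n / 800 + real n / 200)" using sumdev rn by simp
    then have "\<epsilon> * real n \<le> 1 / 40 * real n" by simp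
    then show ?thesis using npos mult_le_cancel_right_pos by blast
  qed
  have kap: "\<kappa> * real l \<le> (1 / 10)\<^sup>2"
  proof -
    have "real (card Z) * real l \<le> r / 800 * r" using card lr by (intro mult_mono) auto
    then show ?thesis using rn npos by (simp add: \<kappa>_def field_simps power2_eq_square)
  qed
  have "\<bar>fdiff l (\<lambda>Y. smooth_part n Z (s + Y)) 0\<bar> \<le> exp (- real l) * binsum l (\<lambda>Y. smooth_part n Z (s + Y))"
  proof (rule tame_fdiff_le[OF tame])
    have "0 \<le> \<epsilon>" unfolding \<epsilon>_def using e_nonneg by (simp add: sum_nonneg)
    moreover have "sqrt (\<kappa> * real l) \<le> 1 / 10" by (rule real_le_lsqrt[OF _ kap]) simp
    ultimately have "exp (3 * \<epsilon>) * (\<epsilon> + sqrt (\<kappa> * real l)) \<le> exp 1 * (1 / 40 + 1 / 10)"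
      using eps by (intro mult_mono) (auto simp: \<kappa>_def)
    \<comment> \<open>As 1/40 + 1/10 = 1/8, this asks for e^2 \<le> 16, and e \<le> 3 is
      enough.\<close>
    also have "\<dots> \<le> 2 * exp (- 1)"
    proof -
      have "exp 1 * exp 1 \<le> (3 * 3 :: real)" by (intro mult_mono exp_le) auto
      then show ?thesis by (simp add: exp_minus field_simps)
    qed
    finally show "exp (3 * \<epsilon>) * (\<epsilon> + sqrt (\<kappa> * real l)) \<le> 2 * exp (- 1)" .
  qed
  then show ?thesis by (simp add: fdiff_shift)
qed

text \<open>With \<open>s = d0 + j\<close>, the factorials of \<open>s\<close> and
  \<open>M - s\<close> in the denominators of \<open>n choose s\<close> and
  \<open>n choose (Max Z + s)\<close> cancel against the two gap coefficients. The rest regroups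
  into \<open>L choose j\<close>, the joint coefficient and a constant. If \<open>Max Z = 0\<close>,
  the one coefficient supplies both factorials.\<close>

lemma binomial_product_eq:
  assumes Z: "finite Z" "0 \<in> Z" and M: "M + Max Z = n" and L: "L + d0 + d1 = M"
  obtains K :: real where "0 \<le> K"
    "\<And>j. j \<le> L \<Longrightarrow> (\<Prod>z\<in>Z. real (n choose (z + (d0 + j)))) * real ((d0 + j) choose d0) * real ((M - (d0 + j)) choose d1)
      = K * (real (L choose j) * smooth_part n Z (d0 + j))"
proof -
  define G where "G = Max Z"
  have mx: "Max Z \<in> Z" by (rule Max_in) (use Z in auto)
  have sub: "{0, G} \<subseteq> Z" using Z mx by (auto simp: G_def)
  define K :: real where "K = (if G = 0 then fact n / (fact d0 * fact d1 * fact L)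
     else fact n * fact n / (fact d0 * fact d1 * fact L * fact (n + G)))"
  have "(\<Prod>z\<in>Z. real (n choose (z + (d0 + j)))) * real ((d0 + j) choose d0) * real ((M - (d0 + j)) choose d1)
      = K * (real (L choose j) * smooth_part n Z (d0 + j))" if j: "j \<le> L" for j
  proof -
    define s where "s = d0 + j"
    define i where "i = L - j"
    have Li: "L = i + j" and Ms: "M - s = d1 + i" and ns: "n - s = G + d1 + i" and ngs: "n - (G + s) = d1 + i"
      and nGs: "n + G - (G + s) = G + d1 + i"
      using j M L by (auto simp: s_def i_def G_def)
    have le: "s \<le> n" "G + s \<le> n" using j M L by (auto simp: s_def G_def)
    have c: "real (s choose d0) = fact s / (fact d0 * fact j)"
      "real ((M - s) choose d1) = fact (d1 + i) / (fact d1 * fact i)"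
      "real (L choose j) = fact L / (fact j * fact i)"
      "real (n choose s) = fact n / (fact s * fact (G + d1 + i))"
      "real (n choose (G + s)) = fact n / (fact (G + s) * fact (d1 + i))"
      "real ((n + G) choose (G + s)) = fact (n + G) / (fact (G + s) * fact (G + d1 + i))"
      unfolding Ms using le by (auto simp: binomial_fact s_def Li ns[unfolded s_def] ngs[unfolded s_def] nGs[unfolded s_def])
    have p: "(\<Prod>z\<in>Z. real (n choose (z + s))) = (\<Prod>z\<in>{0, G}. real (n choose (z + s))) * (\<Prod>z\<in>Z - {0, G}. real (n choose (z + s)))"
      using prod.subset_diff[OF sub Z(1), of "\<lambda>z. real (n choose (z + s))"] by simp
    have "(\<Prod>z\<in>{0, G}. real (n choose (z + s))) * real (s choose d0) * real ((M - s) choose d1)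
       = K * (real (L choose j) * (if G = 0 then 1 else real ((n + G) choose (G + s))))"
    proof (cases "G = 0")
      case True
      have "real (n choose s) * real (s choose d0) * real ((M - s) choose d1) = K * real (L choose j)"
        unfolding c K_def using True by (simp add: field_simps)
      then show ?thesis using True by simp
    next
      case False
      have "real (n choose s) * real (n choose (G + s)) * real (s choose d0) * real ((M - s) choose d1)
          = K * (real (L choose j) * real ((n + G) choose (G + s)))"
        unfolding c K_def using False by (simp add: field_simps)
      then show ?thesis using False by simp
    qed
    then show ?thesis
      unfolding smooth_part_def s_def[symmetric] G_def[symmetric] p by (simp add: mult_ac)
  qed
  moreover have "0 \<le> K" by (simp add: K_def)
  ultimately show thesis using that by blast
qed

lemma abs_alternating_sum_le:
  assumes Z: "finite Z" "0 \<in> Z" and M: "M + Max Z = n" and n: "10000 \<le> n" and l: "real l \<le> sqrt (real n)"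
    and lM: "l + d0 + d1 \<le> M"
  defines "g \<equiv> \<lambda>s. (\<Prod>z\<in>Z. real (n choose (z + s))) * real (s choose d0) * real ((M - s) choose d1)"
  shows "\<bar>\<Sum>s\<le>M. (-1) ^ s * g s\<bar>
    \<le> (\<Sum>s\<le>M. g s * (exp (- real l) + of_bool (spread n ((+) s ` Z) > sqrt (real n) / 800)))"
proof -
  define L where "L = M - d0 - d1"
  have L: "L + d0 + d1 = M" "l \<le> L" using lM by (auto simp: L_def)
  obtain K where K: "0 \<le> K" and g: "\<And>j. j \<le> L \<Longrightarrow> g (d0 + j) = K * (real (L choose j) * smooth_part n Z (d0 + j))"
    using binomial_product_eq[OF Z M L(1)] unfolding g_def by blast
  let ?bad = "\<lambda>s. spread n ((+) s ` Z) > sqrt (real n) / 800"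
  \<comment> \<open>A general weight \<open>\<sigma>\<close> lets the same reduction serve the
    alternating sum and, read backwards, the final bound. Terms outside
    \<open>d0 \<le> s \<le> M - d1\<close> vanish.\<close>
  have red: "(\<Sum>s\<le>M. \<sigma> s * g s) = K * binsum L (\<lambda>j. \<sigma> (d0 + j) * smooth_part n Z (d0 + j))" for \<sigma> :: "nat \<Rightarrow> real"
  proof -
    have "(\<Sum>s\<le>M. \<sigma> s * g s) = (\<Sum>s\<in>(+) d0 ` {..L}. \<sigma> s * g s)"
    proof (rule sum.mono_neutral_right)
      show "\<forall>s\<in>{..M} - (+) d0 ` {..L}. \<sigma> s * g s = 0"
      proof
        fix s assume s: "s \<in> {..M} - (+) d0 ` {..L}"
        have "s < d0 \<or> M - s < d1"
        proof (rule ccontr)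
          assume "\<not> (s < d0 \<or> M - s < d1)"
          then have "s = d0 + (s - d0)" "s - d0 \<le> L" using s L by auto
          then show False using s by blast
        qed
        then show "\<sigma> s * g s = 0" by (auto simp: g_def binomial_eq_0)
      qed
    qed (use L in auto)
    also have "\<dots> = (\<Sum>j\<le>L. \<sigma> (d0 + j) * g (d0 + j))"
      by (subst sum.reindex) (auto simp: inj_on_def)
    also have "\<dots> = K * binsum L (\<lambda>j. \<sigma> (d0 + j) * smooth_part n Z (d0 + j))"
      unfolding binsum_def sum_distrib_left by (rule sum.cong) (simp_all add: g mult_ac)
    finally show ?thesis .
  qed
  have sp: "0 \<le> smooth_part n Z t" for t
    unfolding smooth_part_def by (auto intro!: mult_nonneg_nonneg prod_nonneg)
  have "\<bar>\<Sum>s\<le>M. (-1) ^ s * g s\<bar> = K * \<bar>binsum L (\<lambda>j. (-1) ^ j * smooth_part n Z (d0 + j))\<bar>"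
    unfolding red using K binsum_mult_left[of L "(-1) ^ d0" "\<lambda>j. (-1) ^ j * smooth_part n Z (d0 + j)"]
    by (simp add: abs_mult power_add mult.assoc power_abs)
  also have "\<dots> \<le> K * binsum L (\<lambda>j. smooth_part n Z (d0 + j) * (exp (- real l) + of_bool (?bad (d0 + j))))"
  proof (rule mult_left_mono[OF alternating_binsum_le[OF L(2)] K])
    fix t assume t: "t + l \<le> L" "\<exists>j\<le>l. \<not> ?bad (d0 + (t + j))"
    then obtain j where j: "j \<le> l" "\<not> ?bad (d0 + t + j)" by (auto simp: add.assoc)
    have "\<bar>fdiff l (smooth_part n Z) (d0 + t)\<bar> \<le> exp (- real l) * binsum l (\<lambda>i. smooth_part n Z (d0 + t + i))"
      by (rule fdiff_smooth_part_le[OF Z n l _ j(1)]) (use t L M j in auto)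
    then show "\<bar>fdiff l (\<lambda>j. smooth_part n Z (d0 + j)) t\<bar> \<le> exp (- real l) * binsum l (\<lambda>j. smooth_part n Z (d0 + (t + j)))"
      by (simp add: fdiff_shift add.assoc)
  qed (use sp in auto)
  also have "\<dots> = (\<Sum>s\<le>M. g s * (exp (- real l) + of_bool (?bad s)))"
    using red[of "\<lambda>s. exp (- real l) + of_bool (?bad s)"] by (simp add: mult.commute)
  finally show ?thesis .
qed

section \<open>Averaging over the outer deletions\<close>

text \<open>The generating function factors over the two sides. Both sums run up to
  \<open>M\<close>, beyond the nonzero terms, so that their ranges do not depend on
  \<open>s\<close>. Later \<open>x = \<delta>\<close> gives total mass 1 and
  \<open>x = \<delta> * exp (- 1)\<close> an exponential moment of the number of deletions.\<close>

lemma binomial_pair_sum: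
  fixes p x :: real
  assumes "s \<le> M"
  shows "(\<Sum>d1\<le>M. \<Sum>d0\<le>M. real (s choose d0) * real ((M - s) choose d1) * (p ^ (d0 + d1) * x ^ (M - d0 - d1))) = (p + x) ^ M"
proof -
  have prod_eq: "real (s choose d0) * real ((M - s) choose d1) * (p ^ (d0 + d1) * x ^ (M - d0 - d1))
      = (real (s choose d0) * p ^ d0 * x ^ (s - d0)) * (real ((M - s) choose d1) * p ^ d1 * x ^ (M - s - d1))" for d0 d1
  proof (cases "d0 \<le> s \<and> d1 \<le> M - s")
    case True
    then have "M - d0 - d1 = (s - d0) + (M - s - d1)" using assms by auto
    then show ?thesis by (simp add: power_add)
  qed (auto simp: binomial_eq_0)
  have ext: "(\<Sum>d\<le>M. real (m choose d) * p ^ d * x ^ (m - d)) = (p + x) ^ m" if "m \<le> M" for m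
    unfolding binomial_ring
    by (rule sum.mono_neutral_right) (use that in \<open>auto simp: binomial_eq_0\<close>)
  have "(\<Sum>d1\<le>M. \<Sum>d0\<le>M. real (s choose d0) * real ((M - s) choose d1) * (p ^ (d0 + d1) * x ^ (M - d0 - d1)))
      = (\<Sum>d0\<le>M. real (s choose d0) * p ^ d0 * x ^ (s - d0)) * (\<Sum>d1\<le>M. real ((M - s) choose d1) * p ^ d1 * x ^ (M - s - d1))"
    unfolding prod_eq sum_distrib_left sum_distrib_right by (rule refl)
  also have "\<dots> = (p + x) ^ M"
    using assms by (simp only: ext[OF assms] ext[OF diff_le_self] power_add[symmetric] le_add_diff_inverse)
  finally show ?thesis .
qed

text \<open>The inner \<open>path_op\<close> does not involve \<open>s\<close>: the shift enters
  only through the two binomial coefficients. This separation allows the alternating sum over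
  \<open>s\<close> to be taken first.\<close>

lemma path_op_translate_expand:
  assumes Z: "finite Z" "0 \<in> Z" and M: "M + Max Z = n" and s: "s \<le> M"
  shows "path_op \<delta> ((+) s ` Z) (Suc n) \<phi> [] =
    (\<Sum>d1\<le>M. \<Sum>d0\<le>M. real (s choose d0) * real ((M - s) choose d1) * ((1 - \<delta>) ^ (d0 + d1) * \<delta> ^ (M - d0 - d1))
      * path_op \<delta> Z (Suc (Max Z)) (\<lambda>y. \<phi> (replicate d0 False @ y)) (replicate d1 False))"
    (is "_ = (\<Sum>d1\<le>M. \<Sum>d0\<le>M. ?w d0 d1 * ?R d0 d1)")
proof -
  let ?c = "\<lambda>m d. real (m choose d) * (1 - \<delta>) ^ d * \<delta> ^ (m - d)"
  have "(+) s ` Z \<subseteq> {..<s + Suc (Max Z)}" using Z by (auto simp: less_Suc_eq_le)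
  moreover have "Suc n = (s + Suc (Max Z)) + (M - s)" using M s by simp
  ultimately have "path_op \<delta> ((+) s ` Z) (Suc n) \<phi> [] =
      path_op \<delta> {} (M - s) (path_op \<delta> Z (Suc (Max Z)) (path_op \<delta> {} s \<phi>)) []"
    by (simp only: path_op_append path_op_translate)
  also have "\<dots> = (\<Sum>d1\<le>M - s. ?c (M - s) d1 * (\<Sum>d0\<le>s. ?c s d0 * ?R d0 d1))"
    unfolding path_op_empty_eq[of \<delta> "M - s"]
    unfolding path_op_empty_eq[of \<delta> s] path_op_sum by (simp only: append_Nil2)
  also have "\<dots> = (\<Sum>d1\<le>M - s. \<Sum>d0\<le>s. ?w d0 d1 * ?R d0 d1)"
    unfolding sum_distrib_left
  proof (intro sum.cong refl)
    fix d1 d0 assume "d1 \<in> {..M - s}" "d0 \<in> {..s}"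
    then have "M - d0 - d1 = (s - d0) + (M - s - d1)" using s by auto
    then show "?c (M - s) d1 * (?c s d0 * ?R d0 d1) = ?w d0 d1 * ?R d0 d1"
      by (simp only: power_add mult_ac)
  qed
  also have "\<dots> = (\<Sum>d1\<le>M - s. \<Sum>d0\<le>M. ?w d0 d1 * ?R d0 d1)"
    by (intro sum.cong refl sum.mono_neutral_left) (use s in \<open>auto simp: binomial_eq_0\<close>)
  also have "\<dots> = (\<Sum>d1\<le>M. \<Sum>d0\<le>M. ?w d0 d1 * ?R d0 d1)"
    by (intro sum.mono_neutral_left) (auto simp: binomial_eq_0)
  finally show ?thesis .
qed

text \<open>Twice \<open>Max Z\<close> is at most the sum of the deviations of the two extreme
  points. The crude bound n/2 leaves at least n/2 outer positions for counting deletions.\<close>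

lemma spread_small_imp:
  assumes Z: "finite Z" "0 \<in> Z" and n: "0 < n" and spr: "spread n ((+) s ` Z) \<le> sqrt (real n) / 800"
  shows "Max Z \<le> n / 2"
proof (cases "Max Z = 0")
  case False
  define dev where "dev z = \<bar>2 * real (s + z) - real n\<bar>" for z
  have mx: "Max Z \<in> Z" by (rule Max_in) (use Z in auto)
  have r: "0 < sqrt (real n)" "sqrt (real n) * sqrt (real n) = real n" using n by auto
  have "(\<Sum>z\<in>{0, Max Z}. 1 + dev z / sqrt (real n)) \<le> (\<Sum>z\<in>Z. 1 + dev z / sqrt (real n))"
    by (rule sum_mono2) (use Z mx in \<open>auto simp: dev_def\<close>)
  then have "(dev 0 + dev (Max Z)) / sqrt (real n) \<le> sqrt (real n) / 800"
    using spr False unfolding spread_translate dev_def by (simp add: add_divide_distrib)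
  then have "dev 0 + dev (Max Z) \<le> sqrt (real n) / 800 * sqrt (real n)"
    using r by (simp add: pos_divide_le_eq)
  then have "dev 0 + dev (Max Z) \<le> real n / 800" using r by simp
  moreover have "- (2 * real (s + 0) - real n) \<le> dev 0" "2 * real (s + Max Z) - real n \<le> dev (Max Z)"
    unfolding dev_def by (rule abs_ge_minus_self, rule abs_ge_self)
  ultimately show ?thesis by simp
qed simp

lemma exp_one_ge_two: "2 \<le> exp (1::real)"
  using exp_ge_add_one_self[of 1] by simp

text \<open>If at least \<open>l\<close> outer bits are deleted, the alternating bound applies;
  otherwise absolute values are taken and the small probability of so few deletions is used. Each
  case costs one \<open>exp (- l)\<close> and one indicator, whence the factors 2.\<close>

lemma abs_alternating_path_sum_le:
  assumes Z: "finite Z" "0 \<in> Z" and M: "M + Max Z = n" and n: "10000 \<le> n" and l: "real l \<le> sqrt (real n)"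
    and \<delta>: "8 / sqrt (real n) \<le> \<delta>" "\<delta> \<le> 1" and \<phi>: "\<And>y. \<bar>\<phi> y\<bar> \<le> 1"
  defines "h \<equiv> \<lambda>s. \<Prod>z\<in>Z. real (n choose (z + s))"
  shows "\<bar>\<Sum>s\<le>M. (-1) ^ s * h s * path_op \<delta> ((+) s ` Z) (Suc n) \<phi> []\<bar>
    \<le> 2 ^ card Z * (\<Sum>s\<le>M. h s * (2 * exp (- real l) + 2 * of_bool (spread n ((+) s ` Z) > sqrt (real n) / 800)))"
proof -
  let ?bad = "\<lambda>s. spread n ((+) s ` Z) > sqrt (real n) / 800"
  let ?C = "\<lambda>s d0 d1. real (s choose d0) * real ((M - s) choose d1)"
  let ?\<beta> = "\<lambda>d0 d1. (1 - \<delta>) ^ (d0 + d1) * \<delta> ^ (M - d0 - d1)"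
  let ?few = "\<lambda>d0 d1. of_bool (M < l + d0 + d1) :: real"
  define R where "R d0 d1 = path_op \<delta> Z (Suc (Max Z)) (\<lambda>y. \<phi> (replicate d0 False @ y)) (replicate d1 False)" for d0 d1
  have \<delta>0: "0 < \<delta>" using \<delta>(1) n by (smt (verit) divide_pos_pos of_nat_0_less_iff real_sqrt_gt_zero zero_less_numeral less_le_trans)
  have \<beta>: "0 \<le> ?\<beta> d0 d1" for d0 d1 using \<delta>0 \<delta>(2) by simp
  have R: "\<bar>R d0 d1\<bar> \<le> 2 ^ card Z" for d0 d1
  proof -
    have "Z \<inter> {..<Suc (Max Z)} = Z" using Z by (auto simp: less_Suc_eq_le)
    then show ?thesis unfolding R_def
      using abs_path_op_le[of \<delta> "\<lambda>y. \<phi> (replicate d0 False @ y)" Z "Suc (Max Z)"] \<delta>0 \<delta>(2) \<phi> by simp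
  qed
  have h: "0 \<le> h s" for s unfolding h_def by (simp add: prod_nonneg)
  have one: "(\<Sum>d1\<le>M. \<Sum>d0\<le>M. ?C s d0 d1 * ?\<beta> d0 d1) = 1" if "s \<le> M" for s
    using binomial_pair_sum[OF that, of "1 - \<delta>" \<delta>] by simp
  have tail: "(\<Sum>d1\<le>M. \<Sum>d0\<le>M. ?C s d0 d1 * ?\<beta> d0 d1 * ?few d0 d1) \<le> exp (- real l) + of_bool (?bad s)"
    if s: "s \<le> M" for s
  proof (cases "?bad s")
    case True
    have "(\<Sum>d1\<le>M. \<Sum>d0\<le>M. ?C s d0 d1 * ?\<beta> d0 d1 * ?few d0 d1) \<le> (\<Sum>d1\<le>M. \<Sum>d0\<le>M. ?C s d0 d1 * ?\<beta> d0 d1)"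
      using \<delta>0 \<delta>(2) by (intro sum_mono mult_left_le) auto
    also have "\<dots> = 1" by (rule one[OF s])
    finally show ?thesis by (rule order_trans) (simp only: True of_bool_eq le_add_same_cancel2 exp_ge_zero)
  next
    case False
    \<comment> \<open>Exponential Markov bound: with at most \<open>l\<close> deletions,
      \<open>exp (l - (M - d0 - d1))\<close> is at least 1.\<close>
    have le: "?C s d0 d1 * ?\<beta> d0 d1 * ?few d0 d1 \<le> exp (real l) * (?C s d0 d1 * ((1 - \<delta>) ^ (d0 + d1) * (\<delta> * exp (- 1)) ^ (M - d0 - d1)))" for d0 d1
    proof (cases "M < l + d0 + d1 \<and> d0 \<le> s \<and> d1 \<le> M - s")
      case True
      then have "M - d0 - d1 \<le> l" by arith
      then have "real (M - d0 - d1) \<le> real l" by (rule of_nat_mono)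
      then have "1 \<le> exp (real l) * exp (- 1) ^ (M - d0 - d1)"
        by (simp add: exp_of_nat_mult[symmetric] exp_add[symmetric])
      then have "?C s d0 d1 * ?\<beta> d0 d1 * 1 \<le> ?C s d0 d1 * ?\<beta> d0 d1 * (exp (real l) * exp (- 1) ^ (M - d0 - d1))"
        by (intro mult_left_mono mult_nonneg_nonneg \<beta>) auto
      then show ?thesis using True by (simp add: power_mult_distrib mult_ac)
    next
      case False
      have "0 \<le> exp (real l) * (?C s d0 d1 * ((1 - \<delta>) ^ (d0 + d1) * (\<delta> * exp (- 1)) ^ (M - d0 - d1)))"
        using \<delta>0 \<delta>(2) by simp
      moreover have "?C s d0 d1 * ?\<beta> d0 d1 * ?few d0 d1 = 0" using False by (auto simp: binomial_eq_0)
      ultimately show ?thesis by linarith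
    qed
    have "(\<Sum>d1\<le>M. \<Sum>d0\<le>M. ?C s d0 d1 * ?\<beta> d0 d1 * ?few d0 d1)
        \<le> exp (real l) * (1 - \<delta> + \<delta> * exp (- 1)) ^ M"
      unfolding binomial_pair_sum[OF s, symmetric] sum_distrib_left by (intro sum_mono le)
    also have "\<dots> \<le> exp (real l) * exp (- (\<delta> / 2)) ^ M"
    proof (intro mult_left_mono power_mono)
      have "exp (- 1 :: real) \<le> 1 / 2" using exp_one_ge_two by (simp add: exp_minus field_simps)
      then have "\<delta> * exp (- 1) \<le> \<delta> * (1 / 2)" using \<delta>0 by (intro mult_left_mono) auto
      then show "1 - \<delta> + \<delta> * exp (- 1) \<le> exp (- (\<delta> / 2))"
        using exp_ge_add_one_self[of "- (\<delta> / 2)"] by simp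
      show "0 \<le> 1 - \<delta> + \<delta> * exp (- 1)" using \<delta>0 \<delta>(2) by simp
    qed simp
    also have "\<dots> = exp (real l - real M * (\<delta> / 2))"
      by (simp add: exp_of_nat_mult[symmetric] exp_add[symmetric])
    also have "\<dots> \<le> exp (- real l)"
    proof -
      have "real (Max Z) \<le> n / 2" using spread_small_imp[OF Z, of n s] False n by simp
      then have "real n / 2 \<le> real M" using M by linarith
      \<comment> \<open>The constant 8 is fixed here: the exponent \<open>M * \<delta> / 2\<close>
        reaches \<open>2 * sqrt n\<close>, which is at least \<open>2 * l\<close>.\<close>
      then have "real n / 2 * (8 / sqrt (real n) / 2) \<le> real M * (\<delta> / 2)"
        using \<delta> by (intro mult_mono) auto
      also have "real n / 2 * (8 / sqrt (real n) / 2) = 2 * sqrt (real n)"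
        using real_div_sqrt[of "real n"] by simp
      finally show ?thesis using l by simp
    qed
    finally show ?thesis using False by simp
  qed
  have each: "\<bar>\<Sum>s\<le>M. (-1) ^ s * (h s * ?C s d0 d1)\<bar>
      \<le> (\<Sum>s\<le>M. h s * ?C s d0 d1 * (exp (- real l) + of_bool (?bad s) + ?few d0 d1))" for d0 d1
  proof (cases "l + d0 + d1 \<le> M")
    case True
    show ?thesis
      using abs_alternating_sum_le[OF Z M n l True] True by (simp add: h_def mult.assoc)
  next
    case False
    have "\<bar>\<Sum>s\<le>M. (-1) ^ s * (h s * ?C s d0 d1)\<bar> \<le> (\<Sum>s\<le>M. h s * ?C s d0 d1 * 1)"
      by (rule order_trans[OF sum_abs]) (simp add: abs_mult power_abs h)
    also have "\<dots> \<le> (\<Sum>s\<le>M. h s * ?C s d0 d1 * (exp (- real l) + of_bool (?bad s) + ?few d0 d1))"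
      using False by (intro sum_mono mult_left_mono mult_nonneg_nonneg h) auto
    finally show ?thesis .
  qed
  have "(\<Sum>s\<le>M. (-1) ^ s * h s * path_op \<delta> ((+) s ` Z) (Suc n) \<phi> [])
      = (\<Sum>s\<le>M. \<Sum>d1\<le>M. \<Sum>d0\<le>M. ?\<beta> d0 d1 * R d0 d1 * ((-1) ^ s * (h s * ?C s d0 d1)))"
    by (rule sum.cong)
      (simp_all only: path_op_translate_expand[OF Z M] atMost_iff R_def[symmetric] sum_distrib_left mult_ac)
  also have "\<dots> = (\<Sum>d1\<le>M. \<Sum>d0\<le>M. \<Sum>s\<le>M. ?\<beta> d0 d1 * R d0 d1 * ((-1) ^ s * (h s * ?C s d0 d1)))"
    by (subst sum.swap, rule sum.cong, rule refl, rule sum.swap)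
  finally have swap: "(\<Sum>s\<le>M. (-1) ^ s * h s * path_op \<delta> ((+) s ` Z) (Suc n) \<phi> [])
      = (\<Sum>d1\<le>M. \<Sum>d0\<le>M. \<Sum>s\<le>M. ?\<beta> d0 d1 * R d0 d1 * ((-1) ^ s * (h s * ?C s d0 d1)))" .
  have "\<bar>\<Sum>s\<le>M. (-1) ^ s * h s * path_op \<delta> ((+) s ` Z) (Suc n) \<phi> []\<bar>
      \<le> (\<Sum>d1\<le>M. \<Sum>d0\<le>M. \<bar>\<Sum>s\<le>M. ?\<beta> d0 d1 * R d0 d1 * ((-1) ^ s * (h s * ?C s d0 d1))\<bar>)"
    unfolding swap by (rule order_trans[OF sum_abs], rule sum_mono, rule sum_abs)
  also have "\<dots> \<le> (\<Sum>d1\<le>M. \<Sum>d0\<le>M. ?\<beta> d0 d1 * 2 ^ card Z *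
      (\<Sum>s\<le>M. h s * ?C s d0 d1 * (exp (- real l) + of_bool (?bad s) + ?few d0 d1)))"
  proof (intro sum_mono)
    fix d1 d0
    show "\<bar>\<Sum>s\<le>M. ?\<beta> d0 d1 * R d0 d1 * ((-1) ^ s * (h s * ?C s d0 d1))\<bar>
      \<le> ?\<beta> d0 d1 * 2 ^ card Z * (\<Sum>s\<le>M. h s * ?C s d0 d1 * (exp (- real l) + of_bool (?bad s) + ?few d0 d1))"
      (is "\<bar>?lhs\<bar> \<le> _ * ?rhs")
    proof -
      have "?lhs = ?\<beta> d0 d1 * R d0 d1 * (\<Sum>s\<le>M. (-1) ^ s * (h s * ?C s d0 d1))"
        by (rule sum_distrib_left[symmetric])
      then have "\<bar>?lhs\<bar> = ?\<beta> d0 d1 * \<bar>R d0 d1\<bar> * \<bar>\<Sum>s\<le>M. (-1) ^ s * (h s * ?C s d0 d1)\<bar>"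
        by (simp only: abs_mult[of "?\<beta> d0 d1 * R d0 d1"] abs_mult[of "?\<beta> d0 d1"] abs_of_nonneg[OF \<beta>])
      also have "\<dots> \<le> ?\<beta> d0 d1 * 2 ^ card Z * ?rhs"
        by (rule mult_mono[OF mult_left_mono[OF R \<beta>] each mult_nonneg_nonneg[OF \<beta>] abs_ge_zero]) simp
      finally show ?thesis .
    qed
  qed
  also have "\<dots> = (\<Sum>d1\<le>M. \<Sum>d0\<le>M. \<Sum>s\<le>M. 2 ^ card Z * h s *
      (?C s d0 d1 * ?\<beta> d0 d1 * (exp (- real l) + of_bool (?bad s)) + ?C s d0 d1 * ?\<beta> d0 d1 * ?few d0 d1))"
    unfolding sum_distrib_left by (intro sum.cong refl) (simp only: distrib_left mult_ac)
  also have "\<dots> = (\<Sum>s\<le>M. \<Sum>d1\<le>M. \<Sum>d0\<le>M. 2 ^ card Z * h s *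
      (?C s d0 d1 * ?\<beta> d0 d1 * (exp (- real l) + of_bool (?bad s)) + ?C s d0 d1 * ?\<beta> d0 d1 * ?few d0 d1))"
    by (subst (2) sum.swap, rule sum.cong, rule refl, rule sum.swap)
  also have "\<dots> = (\<Sum>s\<le>M. 2 ^ card Z * h s *
      ((\<Sum>d1\<le>M. \<Sum>d0\<le>M. ?C s d0 d1 * ?\<beta> d0 d1) * (exp (- real l) + of_bool (?bad s))
        + (\<Sum>d1\<le>M. \<Sum>d0\<le>M. ?C s d0 d1 * ?\<beta> d0 d1 * ?few d0 d1)))"
    by (simp only: sum_distrib_left sum_distrib_right distrib_left distrib_right sum.distrib mult.assoc)
  also have "\<dots> \<le> (\<Sum>s\<le>M. 2 ^ card Z * h s * (2 * exp (- real l) + 2 * of_bool (?bad s)))"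
  proof (intro sum_mono mult_left_mono)
    fix s assume "s \<in> {..M}"
    then show "(\<Sum>d1\<le>M. \<Sum>d0\<le>M. ?C s d0 d1 * ?\<beta> d0 d1) * (exp (- real l) + of_bool (?bad s))
        + (\<Sum>d1\<le>M. \<Sum>d0\<le>M. ?C s d0 d1 * ?\<beta> d0 d1 * ?few d0 d1) \<le> 2 * exp (- real l) + 2 * of_bool (?bad s)"
      using one[of s] tail[of s] by simp
  qed (simp add: h)
  finally show ?thesis by (simp only: sum_distrib_left mult.assoc)
qed

section \<open>Summation over all position sets\<close>

text \<open>A nonempty set corresponds to its minimum \<open>s\<close> together with the set shifted
  down by \<open>s\<close>.\<close>

lemma sum_Pow_translates:
  fixes F :: "nat set \<Rightarrow> real"
  shows "(\<Sum>X\<in>Pow {..n} - {{}}. F X) = (\<Sum>Z | Z \<subseteq> {..n} \<and> 0 \<in> Z. \<Sum>s\<le>n - Max Z. F ((+) s ` Z))"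
proof -
  have fin: "finite Z" if "Z \<subseteq> {..n}" for Z :: "nat set"
    using that by (rule finite_subset) simp
  have "(\<Sum>X\<in>Pow {..n} - {{}}. F X) =
     (\<Sum>(Z, s)\<in>Sigma {Z. Z \<subseteq> {..n} \<and> 0 \<in> Z} (\<lambda>Z. {..n - Max Z}). F ((+) s ` Z))"
  proof (rule sum.reindex_bij_witness[where j = "\<lambda>X. ((\<lambda>x. x - Min X) ` X, Min X)" and i = "\<lambda>(Z, s). (+) s ` Z"])
    fix X assume X: "X \<in> Pow {..n} - {{}}"
    have mn: "Min X \<in> X" "\<And>x. x \<in> X \<Longrightarrow> Min X \<le> x" using X fin[of X] by auto
    let ?Z = "(\<lambda>x. x - Min X) ` X"
    have inv: "(+) (Min X) ` ?Z = X"
      unfolding image_image using mn(2) by (simp cong: image_cong)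
    then show "(case (?Z, Min X) of (Z, s) \<Rightarrow> (+) s ` Z) = X" by simp
    show "(case (?Z, Min X) of (Z, s) \<Rightarrow> F ((+) s ` Z)) = F X" using inv by simp
    have "finite ?Z" "?Z \<noteq> {}" using X fin[of X] by auto
    then have "Max ?Z \<in> ?Z" by (rule Max_in)
    then obtain x where "x \<in> X" "Max ?Z = x - Min X" by blast
    then have "Min X \<le> n - Max ?Z" using mn(2)[of x] X by fastforce
    moreover have "0 \<in> ?Z" using mn(1) by (auto intro!: image_eqI[of _ _ "Min X"])
    moreover have "?Z \<subseteq> {..n}" using X by fastforce
    ultimately show "(?Z, Min X) \<in> Sigma {Z. Z \<subseteq> {..n} \<and> 0 \<in> Z} (\<lambda>Z. {..n - Max Z})" by simp
  next
    fix p assume p: "p \<in> Sigma {Z. Z \<subseteq> {..n} \<and> 0 \<in> Z} (\<lambda>Z. {..n - Max Z})"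
    obtain Z s where ps: "p = (Z, s)" by (cases p)
    then have Z: "Z \<subseteq> {..n}" "0 \<in> Z" "s \<le> n - Max Z" using p by auto
    have Min: "Min ((+) s ` Z) = s"
      by (rule Min_eqI) (use fin[OF Z(1)] Z(2) in \<open>auto intro!: image_eqI[of _ _ 0]\<close>)
    have "(\<lambda>x. x - s) ` (+) s ` Z = Z" by (simp add: image_image)
    then show "(\<lambda>X. ((\<lambda>x. x - Min X) ` X, Min X)) (case p of (Z, s) \<Rightarrow> (+) s ` Z) = p"
      by (simp add: ps Min)
    have "s + z \<le> n" if "z \<in> Z" for z
    proof -
      have "Max Z \<in> Z" by (rule Max_in) (use fin[OF Z(1)] that in auto)
      then have "z \<le> Max Z" "Max Z \<le> n" using that fin[OF Z(1)] Z by auto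
      then show ?thesis using Z(3) by linarith
    qed
    then show "(case p of (Z, s) \<Rightarrow> (+) s ` Z) \<in> Pow {..n} - {{}}" using Z(2) by (auto simp: ps)
  qed
  also have "\<dots> = (\<Sum>Z | Z \<subseteq> {..n} \<and> 0 \<in> Z. \<Sum>s\<le>n - Max Z. F ((+) s ` Z))"
    by (subst sum.Sigma) auto
  finally show ?thesis .
qed

section \<open>Exponential moments and size bounds for binomial weights\<close>

lemma sum_Pow_prod_le_exp:
  fixes q :: "'a \<Rightarrow> real"
  assumes "finite A" "\<And>x. x \<in> A \<Longrightarrow> 0 \<le> q x"
  shows "(\<Sum>X\<in>Pow A. \<Prod>x\<in>X. q x) \<le> exp (\<Sum>x\<in>A. q x)"
proof -
  have "(\<Sum>X\<in>Pow A. \<Prod>x\<in>X. q x) = (\<Prod>x\<in>A. q x + 1)"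
    using prod_add[OF assms(1), of q "\<lambda>_. 1"] by simp
  also have "\<dots> \<le> (\<Prod>x\<in>A. exp (q x))"
    by (rule prod_mono) (use assms(2) in \<open>auto simp: add.commute intro: exp_ge_add_one_self add_nonneg_nonneg\<close>)
  also have "\<dots> = exp (\<Sum>x\<in>A. q x)" using assms(1) by (simp add: exp_sum)
  finally show ?thesis .
qed

text \<open>The root of 2m + 1 is a form that induction preserves; the step reduces to (2m + 1)(2m +
  3) \<le> (2m + 2)^2.\<close>

lemma central_binomial_le:
  "real ((2 * m) choose m) * sqrt (2 * real m + 1) \<le> 4 ^ m"
proof (induction m)
  case (Suc m)
  have rec: "real ((2 * Suc m) choose Suc m) = real ((2 * m) choose m) * (2 * (2 * real m + 1) / (real m + 1))"
  proof -
    have "real ((2 * Suc m) choose Suc m) = fact (2 * Suc m) / (fact (Suc m) * fact (Suc m))"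
      by (subst binomial_fact) auto
    also have "\<dots> = fact (2 * m) / (fact m * fact m) * (2 * (2 * real m + 1) / (real m + 1))"
      by (simp add: divide_simps) (simp add: algebra_simps)
    also have "fact (2 * m) / (fact m * fact m) = real ((2 * m) choose m)"
      by (subst binomial_fact) auto
    finally show ?thesis .
  qed
  have "sqrt (2 * real (Suc m) + 1) * (2 * (2 * real m + 1) / (real m + 1)) \<le> 4 * sqrt (2 * real m + 1)"
  proof (rule power2_le_imp_le)
    have "(2 * real m + 3) * (2 * real m + 1) \<le> (2 * real m + 2)\<^sup>2" by (simp add: power2_eq_square algebra_simps)
    then have "4 * (2 * real m + 1) * ((2 * real m + 3) * (2 * real m + 1)) \<le> 4 * (2 * real m + 1) * (2 * real m + 2)\<^sup>2"
      by (rule mult_left_mono) simp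
    then show "(sqrt (2 * real (Suc m) + 1) * (2 * (2 * real m + 1) / (real m + 1)))\<^sup>2 \<le> (4 * sqrt (2 * real m + 1))\<^sup>2"
      by (simp add: power_mult_distrib power_divide divide_le_eq) (simp add: power2_eq_square algebra_simps)
  qed simp
  then have "real ((2 * m) choose m) * (sqrt (2 * real (Suc m) + 1) * (2 * (2 * real m + 1) / (real m + 1)))
      \<le> real ((2 * m) choose m) * (4 * sqrt (2 * real m + 1))"
    by (rule mult_left_mono) simp
  also have "\<dots> \<le> 4 * 4 ^ m" using Suc by simp
  finally show ?case unfolding rec by (simp add: mult_ac)
qed simp

text \<open>For n = 2m + 1 the largest coefficient is at most twice the central one of 2m. This
  keeps the entries of both strings at most 1 when \<alpha> \<le> \<open>sqrt n\<close>.\<close>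

lemma odd_binomial_le:
  assumes "odd n"
  shows "real (n choose k) * sqrt (real n) \<le> 2 ^ n"
proof -
  obtain m where m: "n = 2 * m + 1" using assms by (elim oddE)
  have "n choose k \<le> n choose (n div 2)" by (rule binomial_maximum)
  also have "\<dots> \<le> 2 * ((2 * m) choose m)"
    using binomial_maximum'[of m "m - 1"] by (cases m) (simp_all add: m)
  finally have "real (n choose k) \<le> 2 * real ((2 * m) choose m)" by linarith
  then have "real (n choose k) * sqrt (real n) \<le> 2 * real ((2 * m) choose m) * sqrt (real n)"
    by (rule mult_right_mono) simp
  also have "\<dots> \<le> 2 ^ n" using central_binomial_le[of m] by (simp add: m power_mult add.commute)
  finally show ?thesis .
qed

text \<open>The exponential of an absolute value is at most the sum of the two one-sided ones, which
  the binomial theorem evaluates at \<open>t = 1 / sqrt n\<close>. Since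
  \<open>exp t + exp (- t) \<le> 2 * exp (t\<^sup>2)\<close>, each is at most e times 2^n. The 18 is
  3 times 2 times 3, using e \<le> 3 twice.\<close>

lemma sum_binomial_exp_spread_le:
  assumes n: "1 \<le> n"
  shows "(\<Sum>x\<le>n. real (n choose x) * exp (1 + \<bar>2 * real x - real n\<bar> / sqrt (real n))) \<le> 18 * 2 ^ n"
proof -
  define t where "t = 1 / sqrt (real n)"
  have t: "0 \<le> t" "t \<le> 1" "real n * t\<^sup>2 = 1" using n by (auto simp: t_def power_divide)
  have gen: "(\<Sum>x\<le>n. real (n choose x) * exp (u * (2 * real x - real n))) = (exp u + exp (- u)) ^ n" for u
    unfolding binomial_ring
  proof (rule sum.cong)
    fix x assume "x \<in> {..n}"
    then have "exp u ^ x * exp (- u) ^ (n - x) = exp (u * (2 * real x - real n))"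
      by (simp add: exp_of_nat_mult[symmetric] exp_add[symmetric] of_nat_diff algebra_simps)
    then show "real (n choose x) * exp (u * (2 * real x - real n)) = real (n choose x) * exp u ^ x * exp (- u) ^ (n - x)"
      by (simp add: mult.assoc)
  qed simp
  have cosh: "(exp t + exp (- t)) ^ n \<le> 2 ^ n * 3"
  proof -
    have "exp t \<le> 1 + t + t\<^sup>2" using t by (intro exp_bound) auto
    moreover have "exp (- t) \<le> 1 - t + t\<^sup>2"
    proof -
      have "1 \<le> (1 - t + t\<^sup>2) * (1 + t)"
        using t zero_le_power[OF t(1), of 3] by (simp add: power2_eq_square power3_eq_cube algebra_simps)
      also have "\<dots> \<le> (1 - t + t\<^sup>2) * exp t" using t by (intro mult_left_mono exp_ge_add_one_self) auto
      finally show ?thesis by (simp add: exp_minus field_simps)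
    qed
    ultimately have "exp t + exp (- t) \<le> 2 * (1 + t\<^sup>2)" by simp
    also have "\<dots> \<le> 2 * exp (t\<^sup>2)" by (intro mult_left_mono exp_ge_add_one_self) simp
    finally have "(exp t + exp (- t)) ^ n \<le> (2 * exp (t\<^sup>2)) ^ n" by (intro power_mono) auto
    also have "\<dots> = 2 ^ n * exp (real n * t\<^sup>2)" by (simp only: power_mult_distrib exp_of_nat_mult)
    also have "\<dots> = 2 ^ n * exp 1" by (simp only: t(3))
    also have "\<dots> \<le> 2 ^ n * 3" by (intro mult_left_mono exp_le) simp
    finally show ?thesis .
  qed
  have "(\<Sum>x\<le>n. real (n choose x) * exp (1 + \<bar>2 * real x - real n\<bar> / sqrt (real n)))
      \<le> (\<Sum>x\<le>n. exp 1 * (real (n choose x) * exp (t * (2 * real x - real n)) + real (n choose x) * exp ((- t) * (2 * real x - real n))))"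
  proof (rule sum_mono)
    fix x
    have "exp (\<bar>2 * real x - real n\<bar> / sqrt (real n)) \<le> exp (t * (2 * real x - real n)) + exp ((- t) * (2 * real x - real n))"
    proof (cases "2 * real x - real n \<ge> 0")
      case True
      then have "\<bar>2 * real x - real n\<bar> / sqrt (real n) = t * (2 * real x - real n)" by (simp add: t_def)
      then show ?thesis by simp
    next
      case False
      then have "\<bar>2 * real x - real n\<bar> / sqrt (real n) = (- t) * (2 * real x - real n)"
        by (simp add: t_def diff_divide_distrib)
      then show ?thesis by (simp only: le_add_same_cancel2 exp_ge_zero)
    qed
    then have "real (n choose x) * exp 1 * exp (\<bar>2 * real x - real n\<bar> / sqrt (real n))
        \<le> real (n choose x) * exp 1 * (exp (t * (2 * real x - real n)) + exp ((- t) * (2 * real x - real n)))"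
      by (rule mult_left_mono) simp
    then show "real (n choose x) * exp (1 + \<bar>2 * real x - real n\<bar> / sqrt (real n))
      \<le> exp 1 * (real (n choose x) * exp (t * (2 * real x - real n)) + real (n choose x) * exp ((- t) * (2 * real x - real n)))"
      by (simp add: exp_add algebra_simps)
  qed
  also have "\<dots> = exp 1 * (2 * (exp t + exp (- t)) ^ n)"
    unfolding sum_distrib_left[symmetric] sum.distrib gen by (simp add: add.commute)
  also have "\<dots> \<le> 3 * (2 * (2 ^ n * 3))" using cosh exp_le by (intro mult_mono) auto
  finally show ?thesis by simp
qed

text \<open>If \<open>Z\<close> is all even, its translate has the parity of \<open>s\<close> and
  exactly one product survives, giving the sign. Otherwise \<open>0 \<in> Z\<close> forces mixed
  parity and both products vanish.\<close>

lemma parity_prod_translate: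
  fixes q :: "nat \<Rightarrow> real"
  assumes "finite Z" "0 \<in> Z"
  shows "(\<Prod>x\<in>(+) s ` Z. if even x then q x else 0) - (\<Prod>x\<in>(+) s ` Z. if odd x then q x else 0)
    = (if \<forall>z\<in>Z. even z then (-1) ^ s * (\<Prod>x\<in>(+) s ` Z. q x) else 0)"
proof -
  let ?X = "(+) s ` Z"
  have fin: "finite ?X" using assms by simp
  have sX: "s \<in> ?X" using assms(2) by (auto intro!: image_eqI[of _ _ 0])
  have all: "(\<Prod>x\<in>?X. if P x then q x else 0) = (if \<forall>x\<in>?X. P x then \<Prod>x\<in>?X. q x else 0)" for P
    using fin by (auto intro!: prod.cong prod_zero)
  show ?thesis
  proof (cases "\<forall>z\<in>Z. even z")
    case True
    have ev: "(\<forall>x\<in>?X. even x) \<longleftrightarrow> even s" using True sX by auto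
    have od: "(\<forall>x\<in>?X. odd x) \<longleftrightarrow> odd s" using True sX by auto
    show ?thesis unfolding all ev od using True by simp
  next
    case False
    then obtain z where z: "z \<in> Z" "odd z" by blast
    then have zX: "s + z \<in> ?X" by blast
    have "even (s + z) \<longleftrightarrow> odd s" using z(2) by simp
    then have no: "\<not> (\<forall>x\<in>?X. even x)" "\<not> (\<forall>x\<in>?X. odd x)" using sX zX by metis+
    show ?thesis unfolding all if_not_P[OF no(1)] if_not_P[OF no(2)] if_not_P[OF False] by simp
  qed
qed

section \<open>Assembling the bound on the distance\<close>

text \<open>The empty set cancels and the others are grouped into translates. The factor
  \<open>2 ^ card Z\<close> from the flips is spread over the product, turning \<alpha> into
  2\<alpha>; sets of mixed parity are added on the right at nonnegative cost.\<close>

lemma expectation_diff_le: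
  fixes n l :: nat and \<alpha> \<delta> :: real and \<phi> :: "bool list \<Rightarrow> real"
  assumes n: "odd n" "10000 \<le> n" and l: "real l \<le> sqrt (real n)"
    and \<delta>: "8 / sqrt (real n) \<le> \<delta>" "\<delta> \<le> 1" and \<alpha>: "0 < \<alpha>" "\<alpha> \<le> sqrt (real n)"
    and \<phi>: "\<And>y. \<bar>\<phi> y\<bar> \<le> 1"
  shows "measure_pmf.expectation (trace_pmf \<delta> (S_e n \<alpha>)) \<phi> - measure_pmf.expectation (trace_pmf \<delta> (S_o n \<alpha>)) \<phi>
    \<le> (\<Sum>X\<in>Pow {..n} - {{}}. (\<Prod>x\<in>X. 2 * \<alpha> / 2 ^ n * real (n choose x))
        * (2 * exp (- real l) + 2 * of_bool (spread n X > sqrt (real n) / 800)))"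
proof -
  define a where "a = \<alpha> / 2 ^ n"
  define q where "q x = a * real (n choose x)" for x
  define W where "W X = path_op \<delta> X (Suc n) \<phi> []" for X
  define h where "h Z s = (\<Prod>z\<in>Z. real (n choose (z + s)))" for Z s
  have a0: "0 \<le> a" using \<alpha> by (simp add: a_def)
  have \<delta>0: "0 \<le> \<delta>" using \<delta>(1) by (rule order_trans[rotated]) simp
  have q01: "0 \<le> q x \<and> q x \<le> 1" for x
  proof -
    have "\<alpha> * real (n choose x) \<le> sqrt (real n) * real (n choose x)"
      using \<alpha> by (intro mult_right_mono) auto
    also have "\<dots> \<le> 2 ^ n" using odd_binomial_le[OF n(1), of x] by (simp add: mult.commute)
    finally show ?thesis using \<alpha> by (simp add: q_def a_def)
  qed
  have bin: "\<alpha> * bin n (1/2) x = q x" if "x < Suc n" for x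
  proof -
    have "(1/2 :: real) ^ n = (1/2) ^ x * (1/2) ^ (n - x)"
      using that by (simp only: power_add[symmetric] le_add_diff_inverse less_Suc_eq_le)
    then show ?thesis by (simp add: bin_def q_def a_def power_one_over)
  qed
  have Se: "S_e n \<alpha> = map (\<lambda>x. if even x then q x else 0) [0..<Suc n]"
    unfolding S_e_def by (rule map_cong) (simp_all add: bin del: upt_Suc)
  have So: "S_o n \<alpha> = map (\<lambda>x. if odd x then q x else 0) [0..<Suc n]"
    unfolding S_o_def by (rule map_cong) (simp_all add: bin del: upt_Suc)
  have E: "measure_pmf.expectation (trace_pmf \<delta> (map p [0..<Suc n])) \<phi> = (\<Sum>X\<in>Pow {..n}. (\<Prod>x\<in>X. p x) * W X)"
    if "\<And>x. 0 \<le> p x \<and> p x \<le> 1" for p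
    unfolding W_def using expectation_trace_pmf[OF \<delta>0 \<delta>(2), of "map p [0..<Suc n]" \<phi>] that
    by (simp del: upt_Suc add: foldl_step_eq_sum lessThan_Suc_atMost)
  have fin: "finite Z" if "Z \<subseteq> {..n}" for Z :: "nat set"
    using that by (rule finite_subset) simp
  have prodq: "(\<Prod>x\<in>(+) s ` Z. c * real (n choose x)) = c ^ card Z * h Z s" for Z s c
  proof -
    have "(\<Prod>x\<in>(+) s ` Z. c * real (n choose x)) = (\<Prod>z\<in>Z. c * real (n choose (z + s)))"
      by (subst prod.reindex) (simp_all add: add.commute)
    then show ?thesis by (simp add: prod.distrib h_def)
  qed
  have "measure_pmf.expectation (trace_pmf \<delta> (S_e n \<alpha>)) \<phi> - measure_pmf.expectation (trace_pmf \<delta> (S_o n \<alpha>)) \<phi>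
    = (\<Sum>X\<in>Pow {..n}. ((\<Prod>x\<in>X. if even x then q x else 0) - (\<Prod>x\<in>X. if odd x then q x else 0)) * W X)"
    unfolding Se So using q01 by (simp add: E sum_subtractf left_diff_distrib del: upt_Suc)
  also have "\<dots> = (\<Sum>X\<in>Pow {..n} - {{}}. ((\<Prod>x\<in>X. if even x then q x else 0) - (\<Prod>x\<in>X. if odd x then q x else 0)) * W X)"
    by (rule sum.mono_neutral_right) auto
  also have "\<dots> = (\<Sum>Z | Z \<subseteq> {..n} \<and> 0 \<in> Z. \<Sum>s\<le>n - Max Z.
      ((\<Prod>x\<in>(+) s ` Z. if even x then q x else 0) - (\<Prod>x\<in>(+) s ` Z. if odd x then q x else 0)) * W ((+) s ` Z))"
    by (rule sum_Pow_translates)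
  also have "\<dots> \<le> (\<Sum>Z | Z \<subseteq> {..n} \<and> 0 \<in> Z. \<Sum>s\<le>n - Max Z.
      (\<Prod>x\<in>(+) s ` Z. 2 * \<alpha> / 2 ^ n * real (n choose x))
        * (2 * exp (- real l) + 2 * of_bool (spread n ((+) s ` Z) > sqrt (real n) / 800)))"
  proof (rule sum_mono)
    fix Z assume "Z \<in> {Z. Z \<subseteq> {..n} \<and> 0 \<in> Z}"
    then have Z: "finite Z" "0 \<in> Z" "Z \<subseteq> {..n}" using fin by auto
    let ?w = "\<lambda>s. 2 * exp (- real l) + 2 * of_bool (spread n ((+) s ` Z) > sqrt (real n) / 800) :: real"
    have "Max Z \<in> Z" by (rule Max_in) (use Z in auto)
    then have M: "n - Max Z + Max Z = n" using Z by auto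
    have h0: "0 \<le> h Z s" for s by (simp add: h_def prod_nonneg)
    have rhs: "(\<Sum>s\<le>n - Max Z. (\<Prod>x\<in>(+) s ` Z. 2 * \<alpha> / 2 ^ n * real (n choose x)) * ?w s)
        = a ^ card Z * (2 ^ card Z * (\<Sum>s\<le>n - Max Z. h Z s * ?w s))"
      unfolding prodq sum_distrib_left a_def
      by (intro sum.cong refl) (simp add: power_mult_distrib power_divide mult_ac)
    show "(\<Sum>s\<le>n - Max Z. ((\<Prod>x\<in>(+) s ` Z. if even x then q x else 0)
          - (\<Prod>x\<in>(+) s ` Z. if odd x then q x else 0)) * W ((+) s ` Z))
        \<le> (\<Sum>s\<le>n - Max Z. (\<Prod>x\<in>(+) s ` Z. 2 * \<alpha> / 2 ^ n * real (n choose x)) * ?w s)"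
    proof (cases "\<forall>z\<in>Z. even z")
      case True
      have "(\<Sum>s\<le>n - Max Z. ((\<Prod>x\<in>(+) s ` Z. if even x then q x else 0)
          - (\<Prod>x\<in>(+) s ` Z. if odd x then q x else 0)) * W ((+) s ` Z))
          = a ^ card Z * (\<Sum>s\<le>n - Max Z. (-1) ^ s * h Z s * W ((+) s ` Z))"
        unfolding parity_prod_translate[OF Z(1,2)] sum_distrib_left q_def prodq
        using True by (intro sum.cong refl) simp
      also have "\<dots> \<le> a ^ card Z * \<bar>\<Sum>s\<le>n - Max Z. (-1) ^ s * h Z s * W ((+) s ` Z)\<bar>"
        using a0 by (intro mult_left_mono) auto
      also have "\<dots> \<le> a ^ card Z * (2 ^ card Z * (\<Sum>s\<le>n - Max Z. h Z s * ?w s))"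
        using abs_alternating_path_sum_le[OF Z(1,2) M n(2) l \<delta> \<phi>] a0
        by (intro mult_left_mono) (simp_all add: h_def W_def)
      finally show ?thesis unfolding rhs .
    next
      case False
      have "(\<Sum>s\<le>n - Max Z. ((\<Prod>x\<in>(+) s ` Z. if even x then q x else 0)
          - (\<Prod>x\<in>(+) s ` Z. if odd x then q x else 0)) * W ((+) s ` Z)) = 0"
        unfolding parity_prod_translate[OF Z(1,2)] if_not_P[OF False] by simp
      also have "0 \<le> a ^ card Z * (2 ^ card Z * (\<Sum>s\<le>n - Max Z. h Z s * ?w s))"
        using a0 h0 by (intro mult_nonneg_nonneg sum_nonneg) auto
      finally show ?thesis unfolding rhs .
    qed
  qed
  also have "\<dots> = (\<Sum>X\<in>Pow {..n} - {{}}. (\<Prod>x\<in>X. 2 * \<alpha> / 2 ^ n * real (n choose x))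
        * (2 * exp (- real l) + 2 * of_bool (spread n X > sqrt (real n) / 800)))"
    by (rule sum_Pow_translates[symmetric])
  finally show ?thesis .
qed

text \<open>The indicator is at most \<open>exp (spread n X - \<tau>)\<close>, which factorises over
  \<open>X\<close>, so both parts are sums of products over subsets. The exponents are the total
  weight 2\<alpha> and 18 times it.\<close>

lemma sum_weighted_spread_le:
  fixes n :: nat and \<alpha> A \<tau> :: real
  assumes n: "1 \<le> n" and \<alpha>: "0 \<le> \<alpha>" and A: "0 \<le> A"
  shows "(\<Sum>X\<in>Pow {..n} - {{}}. (\<Prod>x\<in>X. 2 * \<alpha> / 2 ^ n * real (n choose x)) * (A + 2 * of_bool (spread n X > \<tau>)))
    \<le> A * exp (2 * \<alpha>) + 2 * exp (36 * \<alpha> - \<tau>)"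
proof -
  define q where "q x = 2 * \<alpha> / 2 ^ n * real (n choose x)" for x
  define e where "e x = exp (1 + \<bar>2 * real x - real n\<bar> / sqrt (real n))" for x
  have q: "0 \<le> q x" for x using \<alpha> by (simp add: q_def)
  have P: "0 \<le> prod q X" for X using q by (simp add: prod_nonneg)
  have e: "0 \<le> e x" for x by (simp add: e_def)
  have fin: "finite X" if "X \<in> Pow {..n}" for X :: "nat set"
    using that by (auto intro: finite_subset)
  have sumq: "(\<Sum>x\<le>n. q x) = 2 * \<alpha>"
  proof -
    have "(\<Sum>x\<le>n. real (n choose x)) = 2 ^ n"
      using choose_row_sum[of n] by (metis of_nat_sum of_nat_power of_nat_numeral)
    then show ?thesis unfolding q_def sum_distrib_left[symmetric] by simp
  qed
  have sumqe: "(\<Sum>x\<le>n. q x * e x) \<le> 36 * \<alpha>"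
  proof -
    have "(\<Sum>x\<le>n. q x * e x) = 2 * \<alpha> / 2 ^ n * (\<Sum>x\<le>n. real (n choose x) * e x)"
      by (simp add: q_def sum_distrib_left mult.assoc)
    also have "\<dots> \<le> 2 * \<alpha> / 2 ^ n * (18 * 2 ^ n)"
      unfolding e_def using \<alpha> by (intro mult_left_mono sum_binomial_exp_spread_le n) auto
    finally show ?thesis by simp
  qed
  have pt: "prod q X * (A + 2 * of_bool (spread n X > \<tau>)) \<le> A * prod q X + 2 * exp (- \<tau>) * (\<Prod>x\<in>X. q x * e x)"
    if X: "X \<in> Pow {..n}" for X
  proof -
    have "of_bool (spread n X > \<tau>) \<le> exp (spread n X - \<tau>)" by simp
    also have "\<dots> = exp (- \<tau>) * prod e X"
      using fin[OF X] by (simp add: spread_def e_def exp_sum[symmetric] exp_add[symmetric])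
    finally have "prod q X * (2 * of_bool (spread n X > \<tau>)) \<le> prod q X * (2 * (exp (- \<tau>) * prod e X))"
      by (intro mult_left_mono P) simp_all
    then show ?thesis by (simp add: prod.distrib algebra_simps)
  qed
  have "(\<Sum>X\<in>Pow {..n} - {{}}. prod q X * (A + 2 * of_bool (spread n X > \<tau>)))
      \<le> (\<Sum>X\<in>Pow {..n}. prod q X * (A + 2 * of_bool (spread n X > \<tau>)))"
    by (rule sum_mono2) (use P A in auto)
  also have "\<dots> \<le> (\<Sum>X\<in>Pow {..n}. A * prod q X + 2 * exp (- \<tau>) * (\<Prod>x\<in>X. q x * e x))"
    by (rule sum_mono) (rule pt)
  also have "\<dots> = A * (\<Sum>X\<in>Pow {..n}. prod q X) + 2 * exp (- \<tau>) * (\<Sum>X\<in>Pow {..n}. \<Prod>x\<in>X. q x * e x)"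
    by (simp only: sum.distrib sum_distrib_left)
  also have "\<dots> \<le> A * exp (2 * \<alpha>) + 2 * exp (- \<tau>) * exp (36 * \<alpha>)"
  proof (intro add_mono mult_left_mono)
    show "(\<Sum>X\<in>Pow {..n}. prod q X) \<le> exp (2 * \<alpha>)"
      unfolding sumq[symmetric] by (rule sum_Pow_prod_le_exp) (simp_all add: q)
    have "(\<Sum>X\<in>Pow {..n}. \<Prod>x\<in>X. q x * e x) \<le> exp (\<Sum>x\<le>n. q x * e x)"
      by (rule sum_Pow_prod_le_exp) (simp_all add: q e)
    then show "(\<Sum>X\<in>Pow {..n}. \<Prod>x\<in>X. q x * e x) \<le> exp (36 * \<alpha>)"
      by (rule order_trans) (simp add: sumqe)
  qed (use A in auto)
  also have "\<dots> = A * exp (2 * \<alpha>) + 2 * exp (36 * \<alpha> - \<tau>)"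
    by (simp add: mult.assoc exp_add[symmetric])
  finally show ?thesis by (simp add: q_def)
qed

theorem theorem3:
  "\<exists>c c' C :: real. c > 0 \<and> c' > 0 \<and> C > 0 \<and> (\<exists>N :: nat. \<forall>n \<ge> N. odd n \<longrightarrow>
     (\<forall>\<delta> \<alpha> :: real. c / sqrt (real n) \<le> \<delta> \<longrightarrow> \<delta> \<le> 1 \<longrightarrow>
        0 < \<alpha> \<longrightarrow> \<alpha> \<le> c' * sqrt (real n) \<longrightarrow>
        tv_dist (trace_pmf \<delta> (S_e n \<alpha>)) (trace_pmf \<delta> (S_o n \<alpha>))
          \<le> exp (- C * sqrt (real n))))"
proof (intro exI conjI allI impI)
  fix n :: nat and \<delta> \<alpha> :: real
  \<comment> \<open>These assumptions instantiate the witnesses: c = 8, c' = 1/100000 and N =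
    2500^2; the final bound gives C = 1/2500.\<close>
  assume n: "6250000 \<le> n" "odd n" and \<delta>: "8 / sqrt (real n) \<le> \<delta>" "\<delta> \<le> 1"
    and \<alpha>: "0 < \<alpha>" "\<alpha> \<le> 1 / 100000 * sqrt (real n)"
  define r where "r = sqrt (real n)"
  define l where "l = nat \<lfloor>r\<rfloor>"
  have r: "2500 \<le> r" unfolding r_def by (rule real_le_rsqrt) (use n in simp)
  have l: "real l \<le> r" "r - 1 \<le> real l" using r by (simp_all add: l_def) 
  have "tv_dist (trace_pmf \<delta> (S_e n \<alpha>)) (trace_pmf \<delta> (S_o n \<alpha>))
      \<le> (2 * exp (- real l) * exp (2 * \<alpha>) + 2 * exp (36 * \<alpha> - r / 800)) / 2"
  proof (rule tv_dist_le_expectation[OF finite_set_trace_pmf finite_set_trace_pmf])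
    fix \<phi> :: "bool list \<Rightarrow> real" assume \<phi>: "\<And>y. \<bar>\<phi> y\<bar> \<le> 1"
    have "10000 \<le> n" "\<alpha> \<le> sqrt (real n)" "1 \<le> n" "0 \<le> \<alpha>" using n \<alpha> r by (auto simp: r_def)
    then show "measure_pmf.expectation (trace_pmf \<delta> (S_e n \<alpha>)) \<phi> - measure_pmf.expectation (trace_pmf \<delta> (S_o n \<alpha>)) \<phi>
        \<le> 2 * exp (- real l) * exp (2 * \<alpha>) + 2 * exp (36 * \<alpha> - r / 800)"
      unfolding r_def
      by (intro order_trans[OF expectation_diff_le sum_weighted_spread_le])
        (use n l(1) \<delta> \<alpha>(1) \<phi> in \<open>auto simp: r_def\<close>)
  qed
  also have "\<dots> = exp (2 * \<alpha> - real l) + exp (36 * \<alpha> - r / 800)"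
    by (simp add: exp_add[symmetric])
  \<comment> \<open>The second exponent decides: 36/100000 - 1/800 = -0.00089, below -1/1250 =
    -0.0008. The first is close to \<open>- r\<close>.\<close>
  also have "\<dots> \<le> exp (- r / 1250) + exp (- r / 1250)"
    by (intro add_mono) (use \<alpha>(2) l(2) r in \<open>simp_all add: r_def[symmetric]\<close>)
  also have "\<dots> = 2 * exp (- r / 1250)" by simp
  \<comment> \<open>Half of the exponent pays for the factor 2, which requires \<open>r\<close> to
    be at least 2500.\<close>
  also have "\<dots> \<le> exp (r / 2500) * exp (- r / 1250)"
  proof (rule mult_right_mono)
    have "2 \<le> exp (1 :: real)" by (rule exp_one_ge_two)
    also have "\<dots> \<le> exp (r / 2500)" using r by simp
    finally show "2 \<le> exp (r / 2500)" .
  qed simp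
  also have "\<dots> = exp (- (1 / 2500) * r)" by (simp add: exp_add[symmetric])
  finally show "tv_dist (trace_pmf \<delta> (S_e n \<alpha>)) (trace_pmf \<delta> (S_o n \<alpha>)) \<le> exp (- (1 / 2500) * sqrt (real n))"
    by (simp add: r_def)
qed simp_all

end
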